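(* (a) A group $G$ is inverse limit slender if and only if every homomorphism $\varphi\colon \widehat{F}\to G$ factors through one of the projections $p_i\colon\widehat{F}\to F_i$ onto a free group of finite rank, i.e. there exist $i\in\mathbb{N}$ and a homomorphism $\overline\varphi\colon F_i\to G$ with $\varphi=\overline\varphi\circ p_i$. (b) The class of inverse limit slender groups is closed under taking subgroups and extensions, and under direct sums and free products of arbitrary cardinality. That is: every subgroup of an inverse limit slender group is inverse limit slender; if $A$ is a normal subgroup of $G$ and both $A$ and $G/A$ are inverse limit slender, then $G$ is inverse limit slender; and if $\{G_\lambda\mid\lambda\in\Lambda\}$ is any family of inverse limit slender groups, then the direct sum $\bigoplus_{\lambda\in\Lambda} G_\lambda$ and the free product of the family are inverse limit slender.
   Context: Groups need not be abelian. An inverse sequence of groups $(H_i,p_i^j)$ consists of groups $H_i$ ($i\in\mathbb{N}$) and homomorphisms (bonding maps) $p_i^j\colon H_j\to H_i$ for $i<j$ with $p_i^jp_j^k=p_i^k$ for $i<j<k$. Its inverse limit is $\varprojlim H_i=\{(h_i)\in\prod_i H_i\mid h_i=p_i^j(h_j)\text{ for } i<j\}$, with projections $p_i\colon\varprojlim H_i\to H_i$. The sequence satisfies the Mittag-Leffler condition if for every $i$ there is $j>i$ such that $p_i^k(H_k)=p_i^j(H_j)$ for all $k\ge j$. A group $G$ is inverse limit slender if for every inverse sequence of groups $(H_i,p_i^j)$ satisfying the Mittag-Leffler condition and every homomorphism $\varphi\colon\varprojlim H_i\to G$ there exist an index $i$ and a homomorphism $\overline\varphi\colon H_i\to G$ such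 that $\varphi=\overline\varphi\circ p_i$. $F_i$ is the free group on $\{x_1,\dots,x_i\}$; for $i<j$ the bonding map $p_i^j\colon F_j\to F_i$ fixes $x_1,\dots,x_i$ and sends $x_{i+1},\dots,x_j$ to $1$. $\widehat{F}=\varprojlim(F_i,p_i^j)$, with projections $p_i\colon\widehat F\to F_i$. The direct sum $\bigoplus_\lambda G_\lambda$ of (possibly non-abelian) groups is the subgroup of $\prod_\lambda G_\lambda$ of elements with finite support. *)

theory Defs
  imports "HOL-Algebra.Product_Groups"
begin

section \<open>Inverse sequences of groups\<close>

text \<open>The bonding map \<open>p i j\<close> goes from \<open>H j\<close> to \<open>H i\<close> and is only meaningful for \<open>i < j\<close>
  and on \<open>carrier (H j)\<close>. Having all \<open>H i\<close> on one type \<open>'h\<close> loses no generality: countably many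
  groups can be copied into a common type.\<close>

definition inverse_sequence ::
    "(nat \<Rightarrow> ('h, 'm) monoid_scheme) \<Rightarrow> (nat \<Rightarrow> nat \<Rightarrow> 'h \<Rightarrow> 'h) \<Rightarrow> bool" where
  "inverse_sequence H p \<longleftrightarrow>
     (\<forall>i. group (H i)) \<and>
     (\<forall>i j. i < j \<longrightarrow> p i j \<in> hom (H j) (H i)) \<and>
     (\<forall>i j k. i < j \<longrightarrow> j < k \<longrightarrow> (\<forall>x\<in>carrier (H k). p i j (p j k x) = p i k x))"

definition inverse_limit ::
    "(nat \<Rightarrow> ('h, 'm) monoid_scheme) \<Rightarrow> (nat \<Rightarrow> nat \<Rightarrow> 'h \<Rightarrow> 'h) \<Rightarrow> (nat \<Rightarrow> 'h) monoid" where
  "inverse_limit H p =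
     (product_group UNIV H)
       \<lparr>carrier := {h \<in> carrier (product_group UNIV H). \<forall>i j. i < j \<longrightarrow> h i = p i j (h j)}\<rparr>"

definition mittag_leffler ::
    "(nat \<Rightarrow> ('h, 'm) monoid_scheme) \<Rightarrow> (nat \<Rightarrow> nat \<Rightarrow> 'h \<Rightarrow> 'h) \<Rightarrow> bool" where
  "mittag_leffler H p \<longleftrightarrow>
     (\<forall>i. \<exists>j>i. \<forall>k\<ge>j. p i k ` carrier (H k) = p i j ` carrier (H j))"

text \<open>The projection from \<open>inverse_limit H p\<close> to \<open>H i\<close> is \<open>\<lambda>h. h i\<close>. The bonding maps \<open>p\<close> occur
  only through the domain of \<open>\<phi>\<close>.\<close>

definition factors_through_projection ::
    "(nat \<Rightarrow> ('h, 'm) monoid_scheme) \<Rightarrow> (nat \<Rightarrow> nat \<Rightarrow> 'h \<Rightarrow> 'h) \<Rightarrow> ('g, 'n) monoid_scheme \<Rightarrow>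
      ((nat \<Rightarrow> 'h) \<Rightarrow> 'g) \<Rightarrow> bool" where
  "factors_through_projection H p G \<phi> \<longleftrightarrow>
     (\<exists>i. \<exists>\<psi>\<in>hom (H i) G. \<forall>h\<in>carrier (inverse_limit H p). \<phi> h = \<psi> (h i))"

text \<open>HOL cannot quantify over types inside a formula, so the type \<open>'h\<close> carrying the groups of the
  test sequences is a parameter. Every group is isomorphic to one whose carrier lies in an infinite
  type, so the notion in the literature is this predicate for all infinite \<open>'h\<close>.\<close>

definition inverse_limit_slender :: "'h itself \<Rightarrow> ('g, 'n) monoid_scheme \<Rightarrow> bool" where
  "inverse_limit_slender (_ :: 'h itself) G \<longleftrightarrow>
     group G \<and>
     (\<forall>(H :: nat \<Rightarrow> 'h monoid) p. inverse_sequence H p \<longrightarrow> mittag_leffler H p \<longrightarrow>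
        (\<forall>\<phi>\<in>hom (inverse_limit H p) G. factors_through_projection H p G \<phi>))"

lemma group_inverse_limit:
  assumes "inverse_sequence H p"
  shows "group (inverse_limit H p)"
proof -
  have gr: "group (H i)" for i
    using assms by (simp add: inverse_sequence_def)
  have hm: "group_hom (H j) (H i) (p i j)" if "i < j" for i j
    using assms that by (simp add: inverse_sequence_def group_hom_def group_hom_axioms_def)
  have prod: "group (product_group UNIV H)"
    by (simp add: gr)
  let ?C = "{h \<in> carrier (product_group UNIV H). \<forall>i j. i < j \<longrightarrow> h i = p i j (h j)}"
  have "subgroup ?C (product_group UNIV H)"
  proof (rule group.subgroupI[OF prod])
    show "?C \<noteq> {}"
    proof -
      have "p i j \<one>\<^bsub>H j\<^esub> = \<one>\<^bsub>H i\<^esub>" if "i < j" for i j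
        using group_hom.hom_one[OF hm[OF that]] .
      then have "\<one>\<^bsub>product_group UNIV H\<^esub> \<in> ?C"
        by (auto simp: gr group.is_monoid)
      then show ?thesis by blast
    qed
  next
    fix a assume "a \<in> ?C"
    then have a: "\<And>i. a i \<in> carrier (H i)" "\<And>i j. i < j \<Longrightarrow> a i = p i j (a j)"
        "a \<in> carrier (product_group UNIV H)"
      by (auto simp: PiE_iff)
    have "inv\<^bsub>product_group UNIV H\<^esub> a = (\<lambda>i. inv\<^bsub>H i\<^esub> a i)"
      using a(3) by (simp add: gr restrict_def)
    moreover have "inv\<^bsub>H i\<^esub> a i = p i j (inv\<^bsub>H j\<^esub> a j)" if "i < j" for i j
      using group_hom.hom_inv[OF hm[OF that] a(1)[of j]] a(2)[OF that] by simp
    ultimately show "inv\<^bsub>product_group UNIV H\<^esub> a \<in> ?C"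
      using a(1) gr by (auto simp: PiE_iff group.inv_closed)
  next
    fix a b assume "a \<in> ?C" "b \<in> ?C"
    then have a: "\<And>i. a i \<in> carrier (H i)" "\<And>i j. i < j \<Longrightarrow> a i = p i j (a j)"
      and b: "\<And>i. b i \<in> carrier (H i)" "\<And>i j. i < j \<Longrightarrow> b i = p i j (b j)"
      by (auto simp: PiE_iff)
    have "a i \<otimes>\<^bsub>H i\<^esub> b i = p i j (a j \<otimes>\<^bsub>H j\<^esub> b j)" if "i < j" for i j
      using group_hom.hom_mult[OF hm[OF that] a(1)[of j] b(1)[of j]] a(2)[OF that] b(2)[OF that]
      by simp
    then show "a \<otimes>\<^bsub>product_group UNIV H\<^esub> b \<in> ?C"
      using a(1) b(1) gr by (auto simp: PiE_iff group.is_monoid monoid.m_closed)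
  qed auto
  then have "group (product_group UNIV H\<lparr>carrier := ?C\<rparr>)"
    by (rule group.subgroup_imp_group[OF prod])
  then show ?thesis
    by (simp add: inverse_limit_def)
qed


section \<open>Free groups\<close>

text \<open>Elements are freely reduced words; the letter \<open>(x, True)\<close> stands for the generator \<open>x\<close>,
  and \<open>(x, False)\<close> for its inverse.\<close>

definition freely_reduced :: "('a \<times> bool) list \<Rightarrow> bool" where
  "freely_reduced = successively (\<lambda>a b. \<not> (fst a = fst b \<and> snd a \<noteq> snd b))"

fun free_cons :: "'a \<times> bool \<Rightarrow> ('a \<times> bool) list \<Rightarrow> ('a \<times> bool) list" where
  "free_cons a [] = [a]"
| "free_cons a (b # w) = (if fst a = fst b \<and> snd a \<noteq> snd b then w else a # b # w)"

definition free_group :: "'a set \<Rightarrow> ('a \<times> bool) list monoid" where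
  "free_group X =
     \<lparr>carrier = {w. fst ` set w \<subseteq> X \<and> freely_reduced w},
      monoid.mult = (\<lambda>u v. foldr free_cons u v),
      one = []\<rparr>"

definition free_gen :: "'a \<Rightarrow> ('a \<times> bool) list" where
  "free_gen x = [(x, True)]"

definition free_lift :: "('g, 'n) monoid_scheme \<Rightarrow> ('a \<Rightarrow> 'g) \<Rightarrow> ('a \<times> bool) list \<Rightarrow> 'g" where
  "free_lift G f w =
     foldr (\<lambda>(x, b) g. (if b then f x else inv\<^bsub>G\<^esub> (f x)) \<otimes>\<^bsub>G\<^esub> g) w \<one>\<^bsub>G\<^esub>"

lemma freely_reduced_Cons:
  "freely_reduced (a # w) \<longleftrightarrow> freely_reduced w \<and> (w = [] \<or> fst a \<noteq> fst (hd w) \<or> snd a = snd (hd w))"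
  by (auto simp: freely_reduced_def successively_Cons)

lemma freely_reduced_Nil [simp]: "freely_reduced []"
  by (simp add: freely_reduced_def)

lemma freely_reduced_free_cons:
  assumes "freely_reduced w" shows "freely_reduced (free_cons a w)"
  using assms by (cases w) (auto simp: freely_reduced_Cons)

lemma free_cons_cancel:
  assumes "freely_reduced w" shows "free_cons (x, b) (free_cons (x, \<not> b) w) = w"
  using assms by (cases w rule: remdups_adj.cases) (auto simp: freely_reduced_Cons prod_eq_iff)

lemma free_cons_reduced: "freely_reduced (a # w) \<Longrightarrow> free_cons a w = a # w"
  by (cases w) (auto simp: freely_reduced_Cons)

lemma set_free_cons: "set (free_cons a w) \<subseteq> insert a (set w)"
  by (cases w) auto

lemma freely_reduced_foldr: "freely_reduced v \<Longrightarrow> freely_reduced (foldr free_cons u v)"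
  by (induction u) (auto intro: freely_reduced_free_cons)

lemma set_foldr_free_cons: "set (foldr free_cons u v) \<subseteq> set u \<union> set v"
  by (induction u) (use set_free_cons in fastforce)+

lemma foldr_free_cons_free_cons:
  assumes "freely_reduced w"
  shows "foldr free_cons (free_cons a u) w = free_cons a (foldr free_cons u w)"
proof (cases u)
  case (Cons b v)
  show ?thesis
  proof (cases "fst a = fst b \<and> snd a \<noteq> snd b")
    case True
    then have "a = (fst a, snd a)" "b = (fst a, \<not> snd a)"
      by (auto simp: prod_eq_iff)
    then have "free_cons a (free_cons b (foldr free_cons v w)) = foldr free_cons v w"
      using free_cons_cancel[of "foldr free_cons v w" "fst a" "snd a"] freely_reduced_foldr[OF assms]
      by simp
    then show ?thesis using True Cons by simp
  qed (use Cons in auto)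
qed simp

lemma foldr_free_cons_assoc:
  assumes "freely_reduced w"
  shows "foldr free_cons (foldr free_cons u v) w = foldr free_cons u (foldr free_cons v w)"
  by (induction u) (auto simp: foldr_free_cons_free_cons[OF assms])

lemma group_free_group: "group (free_group X)"
proof (rule groupI)
  fix w assume w: "w \<in> carrier (free_group X)"
  define u where "u = rev (map (\<lambda>(x, b). (x, \<not> b)) w)"
  have "foldr free_cons (rev (map (\<lambda>(x, b). (x, \<not> b)) v)) v = []" if "freely_reduced v"
    for v :: "('a \<times> bool) list"
    using that by (induction v) (auto simp: freely_reduced_Cons)
  moreover have "fst ` set u = fst ` set w"
    by (force simp: u_def image_image case_prod_beta)
  moreover have "freely_reduced u"
    using w successively_mono[of "\<lambda>a b. \<not> (fst a = fst b \<and> snd a \<noteq> snd b)" w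
        "\<lambda>b a. \<not> (fst a = fst b \<and> snd a \<noteq> snd b)"]
    by (auto simp: u_def free_group_def freely_reduced_def successively_map case_prod_beta)
  ultimately have "u \<in> carrier (free_group X)" "u \<otimes>\<^bsub>free_group X\<^esub> w = \<one>\<^bsub>free_group X\<^esub>"
    using w by (auto simp: free_group_def u_def)
  then show "\<exists>y\<in>carrier (free_group X). y \<otimes>\<^bsub>free_group X\<^esub> w = \<one>\<^bsub>free_group X\<^esub>"
    by blast
next
  fix u v assume uv: "u \<in> carrier (free_group X)" "v \<in> carrier (free_group X)"
  then have "fst ` (set u \<union> set v) \<subseteq> X"
    by (auto simp: free_group_def)
  then have "fst ` set (foldr free_cons u v) \<subseteq> X"
    using image_mono[OF set_foldr_free_cons[of u v], of fst] by (rule order_trans[rotated])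
  then show "u \<otimes>\<^bsub>free_group X\<^esub> v \<in> carrier (free_group X)"
    using uv by (simp add: free_group_def freely_reduced_foldr)
qed (auto simp: free_group_def foldr_free_cons_assoc)

lemma free_gen_in_carrier: "x \<in> X \<Longrightarrow> free_gen x \<in> carrier (free_group X)"
  by (simp add: free_gen_def free_group_def freely_reduced_def)

lemma free_lift_simps [simp]:
  "free_lift G f [] = \<one>\<^bsub>G\<^esub>"
  "free_lift G f (a # w) =
     (if snd a then f (fst a) else inv\<^bsub>G\<^esub> (f (fst a))) \<otimes>\<^bsub>G\<^esub> free_lift G f w"
  by (simp_all add: free_lift_def case_prod_beta)

lemma free_lift_closed:
  assumes "group G" "\<And>x. x \<in> fst ` set w \<Longrightarrow> f x \<in> carrier G"
  shows "free_lift G f w \<in> carrier G"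
proof -
  interpret group G by fact
  show ?thesis using assms(2) by (induction w) auto
qed

lemma free_lift_foldr:
  assumes "group G" "\<And>x. x \<in> fst ` set u \<union> fst ` set v \<Longrightarrow> f x \<in> carrier G"
  shows "free_lift G f (foldr free_cons u v) = free_lift G f u \<otimes>\<^bsub>G\<^esub> free_lift G f v"
proof -
  interpret group G by fact
  have step: "free_lift G f (free_cons a w) = free_lift G f (a # w)"
    if "\<And>x. x \<in> insert (fst a) (fst ` set w) \<Longrightarrow> f x \<in> carrier G" for a w
  proof (cases w)
    case (Cons b v)
    have "free_lift G f v \<in> carrier G"
      using that Cons by (intro free_lift_closed) (auto simp: assms)
    then show ?thesis
      using that Cons by (auto simp flip: m_assoc)
  qed simp
  show ?thesis using assms(2)
  proof (induction u)
    case Nil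
    then have "free_lift G f v \<in> carrier G"
      by (intro free_lift_closed) (auto simp: assms)
    then show ?case by simp
  next
    case (Cons a u)
    have *: "free_lift G f u \<in> carrier G" "free_lift G f v \<in> carrier G"
      using Cons.prems by (auto intro!: free_lift_closed simp: assms)
    have "free_lift G f (foldr free_cons (a # u) v) = free_lift G f (a # foldr free_cons u v)"
      using Cons.prems set_foldr_free_cons[of u v] by (simp only: foldr.simps o_apply)
        (rule step, auto)
    also have "\<dots> = (if snd a then f (fst a) else inv\<^bsub>G\<^esub> (f (fst a))) \<otimes>\<^bsub>G\<^esub>
        (free_lift G f u \<otimes>\<^bsub>G\<^esub> free_lift G f v)"
      using Cons.IH Cons.prems by auto
    also have "\<dots> = free_lift G f (a # u) \<otimes>\<^bsub>G\<^esub> free_lift G f v"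
      using Cons.prems * by (auto simp: m_assoc)
    finally show ?case .
  qed
qed

lemma free_lift_hom:
  assumes "group G" "f \<in> X \<rightarrow> carrier G"
  shows "free_lift G f \<in> hom (free_group X) G"
proof (rule homI)
  fix u v assume "u \<in> carrier (free_group X)" "v \<in> carrier (free_group X)"
  then have *: "\<And>x. x \<in> fst ` set u \<union> fst ` set v \<Longrightarrow> f x \<in> carrier G"
    using assms(2) by (auto simp: free_group_def)
  show "free_lift G f (u \<otimes>\<^bsub>free_group X\<^esub> v) = free_lift G f u \<otimes>\<^bsub>G\<^esub> free_lift G f v"
    using free_lift_foldr[OF assms(1) *] by (simp add: free_group_def)
  show "free_lift G f u \<in> carrier G"
    using * by (intro free_lift_closed assms(1)) auto
qed

lemma free_lift_gen:
  assumes "group G" "f x \<in> carrier G"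
  shows "free_lift G f (free_gen x) = f x"
  using assms by (simp add: free_gen_def group.is_monoid)

lemma free_lift_unique:
  assumes "group G" "h \<in> hom (free_group X) G" "w \<in> carrier (free_group X)"
  shows "h w = free_lift G (\<lambda>x. h (free_gen x)) w"
proof -
  interpret group_hom "free_group X" G h
    using assms by (simp add: group_hom_def group_hom_axioms_def group_free_group)
  show ?thesis using assms(3)
  proof (induction w)
    case Nil
    then show ?case using hom_one by (simp add: free_group_def)
  next
    case (Cons a w)
    have w: "w \<in> carrier (free_group X)" and a: "fst a \<in> X"
      using Cons.prems by (auto simp: free_group_def freely_reduced_Cons)
    have a': "[a] \<in> carrier (free_group X)"
      using a by (auto simp: free_group_def freely_reduced_def)
    have g: "free_gen (fst a) \<in> carrier (free_group X)"
      using a by (rule free_gen_in_carrier)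
    have "a # w = [a] \<otimes>\<^bsub>free_group X\<^esub> w"
      using Cons.prems by (simp add: free_group_def free_cons_reduced)
    then have "h (a # w) = h [a] \<otimes>\<^bsub>G\<^esub> h w"
      using w a' by simp
    moreover have "h [a] = (if snd a then h (free_gen (fst a)) else inv\<^bsub>G\<^esub> h (free_gen (fst a)))"
    proof (cases "snd a")
      case True
      then have "[a] = free_gen (fst a)"
        by (simp add: free_gen_def prod_eq_iff)
      then show ?thesis using True by simp
    next
      case False
      then have "[a] \<otimes>\<^bsub>free_group X\<^esub> free_gen (fst a) = \<one>\<^bsub>free_group X\<^esub>"
        by (simp add: free_gen_def free_group_def)
      then have "[a] = inv\<^bsub>free_group X\<^esub> free_gen (fst a)"
        using a' g by (simp add: group.inv_equality[OF group_free_group])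
      then show ?thesis using False g by simp
    qed
    ultimately show ?case using Cons.IH[OF w] by simp
  qed
qed


section \<open>The inverse sequence of free groups of finite rank\<close>

definition F_seq :: "nat \<Rightarrow> (nat \<times> bool) list monoid" where
  "F_seq i = free_group {1..i}"

definition F_bond :: "nat \<Rightarrow> nat \<Rightarrow> (nat \<times> bool) list \<Rightarrow> (nat \<times> bool) list" where
  "F_bond i j = free_lift (F_seq i) (\<lambda>n. if n \<le> i then free_gen n else \<one>\<^bsub>F_seq i\<^esub>)"

definition F_hat :: "(nat \<Rightarrow> (nat \<times> bool) list) monoid" where
  "F_hat = inverse_limit F_seq F_bond"

lemma group_F_seq: "group (F_seq i)"
  by (simp add: F_seq_def group_free_group)

lemma F_bond_hom: "F_bond i j \<in> hom (F_seq j) (F_seq i)"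
proof -
  interpret group "F_seq i" by (rule group_F_seq)
  have "(\<lambda>n. if n \<le> i then free_gen n else \<one>\<^bsub>F_seq i\<^esub>) \<in> {1..j} \<rightarrow> carrier (F_seq i)"
    using one_closed by (auto simp: F_seq_def intro!: free_gen_in_carrier)
  from free_lift_hom[OF group_F_seq this] show ?thesis
    by (simp add: F_bond_def F_seq_def)
qed

lemma F_bond_gen:
  "1 \<le> n \<Longrightarrow> F_bond i j (free_gen n) = (if n \<le> i then free_gen n else \<one>\<^bsub>F_seq i\<^esub>)"
  unfolding F_bond_def
  by (subst free_lift_gen[OF group_F_seq])
    (auto simp: F_seq_def free_gen_in_carrier group.is_monoid group_free_group)

lemma inverse_sequence_F: "inverse_sequence F_seq F_bond"
  unfolding inverse_sequence_def
proof (intro conjI allI impI ballI)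
  fix i j k :: nat and w
  assume ij: "i < j" and jk: "j < k" and w: "w \<in> carrier (F_seq k)"
  define f where "f n = (if n \<le> i then free_gen n else \<one>\<^bsub>F_seq i\<^esub>)" for n
  have h: "F_bond i j \<circ> F_bond j k \<in> hom (free_group {1..k}) (F_seq i)"
    using hom_compose[OF F_bond_hom[of j k] F_bond_hom[of i j]] by (simp add: F_seq_def)
  have one: "F_bond i j \<one>\<^bsub>F_seq j\<^esub> = \<one>\<^bsub>F_seq i\<^esub>"
    using hom_one[OF F_bond_hom group_F_seq group_F_seq] .
  have "free_lift (F_seq i) (\<lambda>x. (F_bond i j \<circ> F_bond j k) (free_gen x)) v = F_bond i k v"
    if "fst ` set v \<subseteq> {1..k}" for v
    using that
  proof (induction v)
    case Nil
    then show ?case by (simp add: F_bond_def)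
  next
    case (Cons a v)
    then show ?case
      using ij one by (auto simp: F_bond_gen) (auto simp: F_bond_def)
  qed
  moreover have "fst ` set w \<subseteq> {1..k}"
    using w by (simp add: F_seq_def free_group_def)
  ultimately show "F_bond i j (F_bond j k w) = F_bond i k w"
    using free_lift_unique[OF group_F_seq h, of w] w by (simp add: F_seq_def)
qed (auto intro: group_F_seq F_bond_hom)


section \<open>Free products\<close>

text \<open>Elements are the normal forms: words of nontrivial elements of the factors in which
  neighbouring letters come from different factors. The first component of a letter is the index
  of its factor, so the factors need not be disjoint.\<close>

fun free_product_cons ::
    "('l \<Rightarrow> ('g, 'n) monoid_scheme) \<Rightarrow> 'l \<times> 'g \<Rightarrow> ('l \<times> 'g) list \<Rightarrow> ('l \<times> 'g) list" where
  "free_product_cons G a [] = [a]"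
| "free_product_cons G a (b # w) =
     (if fst a = fst b then
        (if snd a \<otimes>\<^bsub>G (fst a)\<^esub> snd b = \<one>\<^bsub>G (fst a)\<^esub> then w
         else (fst a, snd a \<otimes>\<^bsub>G (fst a)\<^esub> snd b) # w)
      else a # b # w)"

definition free_product ::
    "'l set \<Rightarrow> ('l \<Rightarrow> ('g, 'n) monoid_scheme) \<Rightarrow> ('l \<times> 'g) list monoid" where
  "free_product I G =
     \<lparr>carrier = {w. (\<forall>(l, g)\<in>set w. l \<in> I \<and> g \<in> carrier (G l) \<and> g \<noteq> \<one>\<^bsub>G l\<^esub>) \<and>
                    successively (\<lambda>a b. fst a \<noteq> fst b) w},
      monoid.mult = (\<lambda>u v. foldr (free_product_cons G) u v),
      one = []\<rparr>"

definition free_product_incl :: "('l \<Rightarrow> ('g, 'n) monoid_scheme) \<Rightarrow> 'l \<Rightarrow> 'g \<Rightarrow> ('l \<times> 'g) list" where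
  "free_product_incl G l g = (if g = \<one>\<^bsub>G l\<^esub> then [] else [(l, g)])"

definition free_product_lift ::
    "('k, 'o) monoid_scheme \<Rightarrow> ('l \<Rightarrow> 'g \<Rightarrow> 'k) \<Rightarrow> ('l \<times> 'g) list \<Rightarrow> 'k" where
  "free_product_lift K f w = foldr (\<lambda>(l, g) x. f l g \<otimes>\<^bsub>K\<^esub> x) w \<one>\<^bsub>K\<^esub>"

lemma free_product_Nil: "[] \<in> carrier (free_product I G)"
  by (simp add: free_product_def)

lemma free_product_Cons:
  "a # w \<in> carrier (free_product I G) \<longleftrightarrow>
     fst a \<in> I \<and> snd a \<in> carrier (G (fst a)) \<and> snd a \<noteq> \<one>\<^bsub>G (fst a)\<^esub> \<and>
     w \<in> carrier (free_product I G) \<and> (w = [] \<or> fst a \<noteq> fst (hd w))"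
  by (auto simp: free_product_def successively_Cons)

lemma free_product_cons_reduced:
  "a # w \<in> carrier (free_product I G) \<Longrightarrow> free_product_cons G a w = a # w"
  by (cases w) (auto simp: free_product_Cons)

context
  fixes I :: "'l set" and G :: "'l \<Rightarrow> ('g, 'n) monoid_scheme"
  assumes groups: "\<And>l. l \<in> I \<Longrightarrow> group (G l)"
begin

lemma free_product_cons_closed:
  assumes "w \<in> carrier (free_product I G)"
    and "fst a \<in> I" "snd a \<in> carrier (G (fst a))" "snd a \<noteq> \<one>\<^bsub>G (fst a)\<^esub>"
  shows "free_product_cons G a w \<in> carrier (free_product I G)"
  using assms
  by (cases w) (auto simp: free_product_Cons free_product_Nil monoid.m_closed[OF group.is_monoid[OF groups]])

lemma free_product_foldr_closed:
  assumes "u \<in> carrier (free_product I G)" "v \<in> carrier (free_product I G)"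
  shows "foldr (free_product_cons G) u v \<in> carrier (free_product I G)"
  using assms(1)
  by (induction u) (auto simp: free_product_Cons assms(2) intro: free_product_cons_closed)

lemma free_product_cons_cons:
  assumes w: "w \<in> carrier (free_product I G)" and l: "l \<in> I"
    and g: "g \<in> carrier (G l)" "g \<noteq> \<one>\<^bsub>G l\<^esub>" and h: "h \<in> carrier (G l)" "h \<noteq> \<one>\<^bsub>G l\<^esub>"
  shows "free_product_cons G (l, g) (free_product_cons G (l, h) w) =
    (if g \<otimes>\<^bsub>G l\<^esub> h = \<one>\<^bsub>G l\<^esub> then w else free_product_cons G (l, g \<otimes>\<^bsub>G l\<^esub> h) w)"
proof -
  interpret group "G l" using l by (rule groups)
  show ?thesis
  proof (cases w)
    case (Cons b v)
    show ?thesis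
    proof (cases "fst b = l")
      case True
      define k where "k = snd b"
      have b: "b = (l, k)" using True by (simp add: k_def prod_eq_iff)
      have k: "k \<in> carrier (G l)" "k \<noteq> \<one>\<^bsub>G l\<^esub>" and v: "v = [] \<or> l \<noteq> fst (hd v)"
        using w Cons b by (auto simp: free_product_Cons)
      have v': "free_product_cons G (l, g) v = (l, g) # v"
        using v by (cases v) auto
      have 1: "g \<otimes>\<^bsub>G l\<^esub> h \<otimes>\<^bsub>G l\<^esub> k = g \<otimes>\<^bsub>G l\<^esub> (h \<otimes>\<^bsub>G l\<^esub> k)"
        using g h k by (simp add: m_assoc)
      have 2: "g = k" if "h \<otimes>\<^bsub>G l\<^esub> k = \<one>\<^bsub>G l\<^esub>" "g \<otimes>\<^bsub>G l\<^esub> h = \<one>\<^bsub>G l\<^esub>"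
        using that 1 g k by simp
      have 3: "g \<otimes>\<^bsub>G l\<^esub> (h \<otimes>\<^bsub>G l\<^esub> k) = k" if "g \<otimes>\<^bsub>G l\<^esub> h = \<one>\<^bsub>G l\<^esub>"
        using that 1 k by simp
      show ?thesis
        using Cons b v' 1 2 3 g h k by (auto simp: m_assoc)
    next
      case False
      then show ?thesis using Cons by auto
    qed
  qed auto
qed

lemma foldr_free_product_cons_cons:
  assumes w: "w \<in> carrier (free_product I G)" and u: "u \<in> carrier (free_product I G)"
    and a: "fst a \<in> I" "snd a \<in> carrier (G (fst a))" "snd a \<noteq> \<one>\<^bsub>G (fst a)\<^esub>"
  shows "foldr (free_product_cons G) (free_product_cons G a u) w =
    free_product_cons G a (foldr (free_product_cons G) u w)"
proof (cases u)
  case (Cons b v)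
  have v: "v \<in> carrier (free_product I G)"
    and b: "fst b \<in> I" "snd b \<in> carrier (G (fst b))" "snd b \<noteq> \<one>\<^bsub>G (fst b)\<^esub>"
    using u Cons by (auto simp: free_product_Cons)
  show ?thesis
  proof (cases "fst a = fst b")
    case True
    have "free_product_cons G (fst a, snd a)
        (free_product_cons G (fst a, snd b) (foldr (free_product_cons G) v w)) =
      (if snd a \<otimes>\<^bsub>G (fst a)\<^esub> snd b = \<one>\<^bsub>G (fst a)\<^esub> then foldr (free_product_cons G) v w
       else free_product_cons G (fst a, snd a \<otimes>\<^bsub>G (fst a)\<^esub> snd b) (foldr (free_product_cons G) v w))"
      using a b True by (intro free_product_cons_cons free_product_foldr_closed v w) auto
    moreover have "(fst a, snd a) = a" "(fst a, snd b) = b"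
      using True by (auto simp: prod_eq_iff)
    ultimately show ?thesis
      using Cons True by simp
  qed (use Cons in auto)
qed simp

lemma foldr_free_product_cons_assoc:
  assumes "u \<in> carrier (free_product I G)" "v \<in> carrier (free_product I G)"
    "w \<in> carrier (free_product I G)"
  shows "foldr (free_product_cons G) (foldr (free_product_cons G) u v) w =
    foldr (free_product_cons G) u (foldr (free_product_cons G) v w)"
  using assms(1)
  by (induction u)
    (auto simp: free_product_Cons foldr_free_product_cons_cons assms free_product_foldr_closed)

lemma group_free_product: "group (free_product I G)"
proof (rule groupI)
  fix w assume w: "w \<in> carrier (free_product I G)"
  let ?inv = "\<lambda>v. rev (map (\<lambda>(l, g). (l, inv\<^bsub>G l\<^esub> g)) v)"
  have "foldr (free_product_cons G) (?inv v) v = []" if "v \<in> carrier (free_product I G)" for v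
    using that
    by (induction v) (auto simp: free_product_Cons group.l_inv[OF groups] split: prod.splits)
  moreover have "?inv w \<in> carrier (free_product I G)"
    using w successively_mono[of "\<lambda>a b. fst a \<noteq> fst b" w "\<lambda>b a. fst a \<noteq> fst b"]
    by (auto simp: free_product_def successively_map case_prod_beta group.inv_closed[OF groups]
        group.inv_eq_1_iff[OF groups])
  ultimately show "\<exists>y\<in>carrier (free_product I G).
      y \<otimes>\<^bsub>free_product I G\<^esub> w = \<one>\<^bsub>free_product I G\<^esub>"
    using w by (intro bexI[of _ "?inv w"]) (auto simp: free_product_def)
next
  fix u v w
  assume "u \<in> carrier (free_product I G)" "v \<in> carrier (free_product I G)"
    "w \<in> carrier (free_product I G)"
  then show "u \<otimes>\<^bsub>free_product I G\<^esub> v \<otimes>\<^bsub>free_product I G\<^esub> w =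
      u \<otimes>\<^bsub>free_product I G\<^esub> (v \<otimes>\<^bsub>free_product I G\<^esub> w)"
    using foldr_free_product_cons_assoc[of u v w] by (simp add: free_product_def)
next
  fix u v
  assume "u \<in> carrier (free_product I G)" "v \<in> carrier (free_product I G)"
  then show "u \<otimes>\<^bsub>free_product I G\<^esub> v \<in> carrier (free_product I G)"
    using free_product_foldr_closed[of u v] by (simp add: free_product_def)
qed (auto simp: free_product_def)

lemma free_product_incl_hom:
  assumes "l \<in> I"
  shows "free_product_incl G l \<in> hom (G l) (free_product I G)"
proof -
  interpret group "G l" using assms by (rule groups)
  show ?thesis
    by (rule homI) (auto simp: free_product_incl_def free_product_def assms)
qed

context
  fixes K :: "('k, 'o) monoid_scheme" and f :: "'l \<Rightarrow> 'g \<Rightarrow> 'k"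
  assumes K: "group K" and f: "\<And>l. l \<in> I \<Longrightarrow> f l \<in> hom (G l) K"
begin

lemma free_product_lift_simps:
  "free_product_lift K f [] = \<one>\<^bsub>K\<^esub>"
  "free_product_lift K f (a # w) = f (fst a) (snd a) \<otimes>\<^bsub>K\<^esub> free_product_lift K f w"
  by (simp_all add: free_product_lift_def case_prod_beta)

lemma free_product_lift_closed:
  assumes "w \<in> carrier (free_product I G)"
  shows "free_product_lift K f w \<in> carrier K"
proof -
  interpret K: group K by (rule K)
  show ?thesis using assms
    by (induction w) (auto simp: free_product_lift_simps free_product_Cons intro: hom_in_carrier[OF f])
qed

lemma free_product_lift_hom: "free_product_lift K f \<in> hom (free_product I G) K"
proof (rule homI)
  interpret K: group K by (rule K)
  have step: "free_product_lift K f (free_product_cons G a w) =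
      f (fst a) (snd a) \<otimes>\<^bsub>K\<^esub> free_product_lift K f w"
    if a: "fst a \<in> I" "snd a \<in> carrier (G (fst a))" and w: "w \<in> carrier (free_product I G)" for a w
  proof (cases w)
    case (Cons b v)
    have v: "free_product_lift K f v \<in> carrier K"
      and b: "fst b \<in> I" "snd b \<in> carrier (G (fst b))"
      using w Cons by (auto simp: free_product_Cons free_product_lift_closed)
    show ?thesis
    proof (cases "fst a = fst b")
      case True
      have fab: "f (fst a) (snd a) \<otimes>\<^bsub>K\<^esub> f (fst a) (snd b) = f (fst a) (snd a \<otimes>\<^bsub>G (fst a)\<^esub> snd b)"
        using hom_mult[OF f[OF a(1)] a(2)] b True by simp
      have fc: "f (fst a) (snd a) \<in> carrier K" "f (fst a) (snd b) \<in> carrier K"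
        using hom_in_carrier[OF f[OF a(1)]] a b True by auto
      have "f (fst a) (snd a) \<otimes>\<^bsub>K\<^esub> (f (fst a) (snd b) \<otimes>\<^bsub>K\<^esub> free_product_lift K f v) =
          f (fst a) (snd a \<otimes>\<^bsub>G (fst a)\<^esub> snd b) \<otimes>\<^bsub>K\<^esub> free_product_lift K f v"
        using fc v fab by (simp flip: K.m_assoc)
      moreover have "f (fst a) \<one>\<^bsub>G (fst a)\<^esub> = \<one>\<^bsub>K\<^esub>"
        using hom_one[OF f[OF a(1)] groups[OF a(1)] K] .
      ultimately show ?thesis
        using Cons True v by (auto simp: free_product_lift_simps)
    qed (use Cons in \<open>auto simp: free_product_lift_simps\<close>)
  qed (auto simp: free_product_lift_simps)
  fix u v assume u: "u \<in> carrier (free_product I G)" and v: "v \<in> carrier (free_product I G)"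
  show "free_product_lift K f u \<in> carrier K"
    using u by (rule free_product_lift_closed)
  have "free_product_lift K f (foldr (free_product_cons G) u v) =
      free_product_lift K f u \<otimes>\<^bsub>K\<^esub> free_product_lift K f v"
    using u
  proof (induction u)
    case Nil
    then show ?case by (simp add: free_product_lift_simps free_product_lift_closed v)
  next
    case (Cons a u)
    then have a: "fst a \<in> I" "snd a \<in> carrier (G (fst a))" and u: "u \<in> carrier (free_product I G)"
      by (auto simp: free_product_Cons)
    show ?case
      using Cons.IH[OF u] step[OF a free_product_foldr_closed[OF u v]] free_product_lift_closed[OF u]
        free_product_lift_closed[OF v] hom_in_carrier[OF f[OF a(1)] a(2)]
      by (simp add: free_product_lift_simps K.m_assoc)
  qed
  then show "free_product_lift K f (u \<otimes>\<^bsub>free_product I G\<^esub> v) =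
      free_product_lift K f u \<otimes>\<^bsub>K\<^esub> free_product_lift K f v"
    by (simp add: free_product_def)
qed

lemma free_product_lift_incl:
  assumes "l \<in> I" "g \<in> carrier (G l)"
  shows "free_product_lift K f (free_product_incl G l g) = f l g"
  using hom_one[OF f groups K, OF assms(1) assms(1)] hom_in_carrier[OF f, OF assms] K
  by (simp add: free_product_incl_def free_product_lift_simps group.is_monoid)

lemma free_product_lift_unique:
  assumes h: "h \<in> hom (free_product I G) K"
    and hf: "\<And>l g. l \<in> I \<Longrightarrow> g \<in> carrier (G l) \<Longrightarrow> h (free_product_incl G l g) = f l g"
    and w: "w \<in> carrier (free_product I G)"
  shows "h w = free_product_lift K f w"
  using w
proof (induction w)
  case Nil
  then show ?case
    using hom_one[OF h group_free_product K] by (simp add: free_product_def free_product_lift_def)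
next
  case (Cons a w)
  have w: "w \<in> carrier (free_product I G)"
    and a: "fst a \<in> I" "snd a \<in> carrier (G (fst a))" "snd a \<noteq> \<one>\<^bsub>G (fst a)\<^esub>"
    using Cons.prems by (auto simp: free_product_Cons)
  have a': "[a] \<in> carrier (free_product I G)"
    using a by (auto simp: free_product_Cons free_product_Nil)
  have "a # w = [a] \<otimes>\<^bsub>free_product I G\<^esub> w"
    using free_product_cons_reduced[OF Cons.prems] by (simp add: free_product_def)
  then have "h (a # w) = h [a] \<otimes>\<^bsub>K\<^esub> h w"
    using hom_mult[OF h a' w] by simp
  moreover have "h [a] = f (fst a) (snd a)"
    using hf[OF a(1,2)] a(3) by (simp add: free_product_incl_def)
  ultimately show ?case
    using Cons.IH[OF w] by (simp add: free_product_lift_simps)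
qed

end

end

end

theory Submission
  imports Defs "HOL-Algebra.Weak_Morphisms"
begin

text \<open>For a Mittag-Leffler sequence, a homomorphism on the limit factors through a projection iff it
  kills the kernel of some projection. If it kills none of these kernels, choose \<open>h n\<close> in the
  kernel of the \<open>n\<close>-th projection with nontrivial image; as only finitely many \<open>h n\<close> are visible in
  each coordinate, there is a homomorphism from \<open>F_hat\<close> to the limit sending the \<open>n\<close>-th generator
  to \<open>h n\<close>. Hence \<open>G\<close> is inverse limit slender iff every homomorphism \<open>F_hat \<rightarrow> G\<close> kills one of the
  generators. In this form closure under subgroups and extensions is immediate, and for direct sums
  the image of a suitable infinite product of generators would have infinite support. The kernel of
  the map from the free product to the direct sum contains no nontrivial conjugate of an element
  of a factor, so the length of \<open>w\<close> grows under taking powers there, and Higman's argument for free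
  groups applies to it; the free product is then an extension of slender groups.\<close>


section \<open>Inverse limits\<close>

lemma carrier_inverse_limit:
  "h \<in> carrier (inverse_limit H p) \<longleftrightarrow>
     (\<forall>i. h i \<in> carrier (H i)) \<and> (\<forall>i j. i < j \<longrightarrow> h i = p i j (h j))"
  by (auto simp: inverse_limit_def PiE_iff)

lemma mult_inverse_limit [simp]:
  "x \<otimes>\<^bsub>inverse_limit H p\<^esub> y = (\<lambda>i. x i \<otimes>\<^bsub>H i\<^esub> y i)"
  by (simp add: inverse_limit_def restrict_def)

lemma one_inverse_limit [simp]: "\<one>\<^bsub>inverse_limit H p\<^esub> = (\<lambda>i. \<one>\<^bsub>H i\<^esub>)"
  by (simp add: inverse_limit_def restrict_def)

lemma nat_pow_inverse_limit [simp]: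
  "x [^]\<^bsub>inverse_limit H p\<^esub> (n :: nat) = (\<lambda>i. x i [^]\<^bsub>H i\<^esub> n)"
  by (induction n) simp_all

lemma inverse_limit_projection_hom: "(\<lambda>h. h i) \<in> hom (inverse_limit H p) (H i)"
  by (auto simp: hom_def carrier_inverse_limit)

lemma inverse_limit_one_below:
  assumes H: "inverse_sequence H p" and h: "h \<in> carrier (inverse_limit H p)"
    and "h n = \<one>\<^bsub>H n\<^esub>" "i \<le> n"
  shows "h i = \<one>\<^bsub>H i\<^esub>"
proof (cases "i = n")
  case False
  then have "i < n" using assms by simp
  then have "h i = p i n \<one>\<^bsub>H n\<^esub>"
    using h assms by (auto simp: carrier_inverse_limit)
  also have "\<dots> = \<one>\<^bsub>H i\<^esub>"
    using H \<open>i < n\<close> by (intro hom_one) (auto simp: inverse_sequence_def)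
  finally show ?thesis .
qed (use assms in simp)

text \<open>The bonding maps send stable images onto stable images, so an element of the stable
  image in \<open>H n\<close> lifts step by step to a coherent sequence. The stable image is
  attained at the level \<open>J n\<close>, which serves as \<open>j\<close>.\<close>

lemma mittag_leffler_stable_image:
  fixes H :: "nat \<Rightarrow> ('h, 'm) monoid_scheme"
  assumes H: "inverse_sequence H p" and ml: "mittag_leffler H p"
  obtains j where "n < j" "p n j ` carrier (H j) \<subseteq> (\<lambda>h. h n) ` carrier (inverse_limit H p)"
proof -
  obtain J where J: "\<And>i. i < J i" "\<And>i k. J i \<le> k \<Longrightarrow> p i k ` carrier (H k) = p i (J i) ` carrier (H (J i))"
    using ml unfolding mittag_leffler_def by metis
  have comp: "p i j (p j k x) = p i k x" if "i < j" "j < k" "x \<in> carrier (H k)" for i j k x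
    using H that by (auto simp: inverse_sequence_def)
  have closed: "p i j x \<in> carrier (H i)" if "i < j" "x \<in> carrier (H j)" for i j x
    using H that by (auto simp: inverse_sequence_def hom_def)
  define S where "S i = p i (J i) ` carrier (H (J i))" for i
  have S_sub: "S i \<subseteq> carrier (H i)" for i
    using J(1) closed by (auto simp: S_def)
  have lift: "\<exists>z\<in>S (Suc i). p i (Suc i) z = y" if y: "y \<in> S i" for i y
  proof -
    \<comment> \<open>Beyond both thresholds the images of \<open>H k\<close> in levels
      \<open>i\<close> and \<open>Suc i\<close> are the stable ones, so a single preimage
      \<open>x\<close> serves for both levels.\<close>
    define k where "k = max (J i) (J (Suc i))"
    have k: "Suc i < k" using J(1)[of "Suc i"] by (simp add: k_def)
    obtain x where x: "x \<in> carrier (H k)" "y = p i k x"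
      using y J(2)[of i k] unfolding S_def k_def by (metis imageE max.cobounded1)
    have "p (Suc i) k x \<in> S (Suc i)"
      using x J(2)[of "Suc i" k] unfolding S_def k_def by (metis imageI max.cobounded2)
    then show ?thesis using comp[OF _ k x(1), of i] x(2) by auto
  qed
  \<comment> \<open>The values \<open>p i i\<close> are unspecified; putting the identity there lets
    coherence be used for \<open>\<le>\<close> instead of \<open><\<close>.\<close>
  define q where "q i j = (if i = j then id else p i j)" for i j
  have qcomp: "q i j (q j k x) = q i k x" if "i \<le> j" "j \<le> k" "x \<in> carrier (H k)" for i j k x
    using that comp[of i j k x] by (auto simp: q_def)
  have "S n \<subseteq> (\<lambda>h. h n) ` carrier (inverse_limit H p)"
  proof
    fix y assume "y \<in> S n"
    \<comment> \<open>The clause \<open>a = 0 \<longrightarrow> s = y\<close> in the choice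
      predicate makes the sequence start at \<open>y\<close>.\<close>
    then have "\<exists>s. s 0 = y \<and> (\<forall>a. s a \<in> S (n + a) \<and> p (n + a) (n + Suc a) (s (Suc a)) = s a)"
      using lift by (intro dependent_nat_choice[where P = "\<lambda>a s. s \<in> S (n + a) \<and> (a = 0 \<longrightarrow> s = y)"
          and Q = "\<lambda>a s t. p (n + a) (n + Suc a) t = s", THEN ex_forward]) auto
    then obtain s where s: "s 0 = y" "\<And>a. s a \<in> S (n + a)"
      "\<And>a. p (n + a) (n + Suc a) (s (Suc a)) = s a" by blast
    have sc: "s a \<in> carrier (H (n + a))" for a
      using s(2) S_sub by blast
    have down: "q (n + a) (n + (a + d)) (s (a + d)) = s a" for a d
    proof (induction d)
      case (Suc d)
      have "q (n + a) (n + (a + Suc d)) (s (a + Suc d)) =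
          q (n + a) (n + (a + d)) (q (n + (a + d)) (n + Suc (a + d)) (s (Suc (a + d))))"
        using qcomp sc[of "Suc (a + d)"] by simp
      also have "q (n + (a + d)) (n + Suc (a + d)) (s (Suc (a + d))) = s (a + d)"
        using s(3)[of "a + d"] by (simp add: q_def)
      finally show ?case using Suc by simp
    qed (simp add: q_def)
    \<comment> \<open>The sequence \<open>s\<close> only covers levels from \<open>n\<close> on.
      Reading coordinate \<open>i\<close> off at level \<open>n + i\<close>, which is at least
      \<open>i\<close> and at least \<open>n\<close>, avoids a case distinction.\<close>
    define h where "h i = q i (n + i) (s i)" for i
    have "h \<in> carrier (inverse_limit H p)"
      unfolding carrier_inverse_limit
    proof (intro conjI allI impI)
      show "h i \<in> carrier (H i)" for i
        using closed sc[of i] by (auto simp: h_def q_def)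
      fix i j :: nat assume ij: "i < j"
      have "p i j (h j) = q i j (q j (n + j) (s j))"
        using ij by (simp add: q_def h_def)
      also have "\<dots> = q i (n + i) (q (n + i) (n + j) (s j))"
        using qcomp ij sc[of j] by simp
      also have "q (n + i) (n + j) (s j) = s i"
        using down[of i "j - i"] ij by simp
      finally show "h i = p i j (h j)" by (simp add: h_def)
    qed
    moreover have "h n = y"
      using down[of 0 n] s(1) by (simp add: h_def)
    ultimately show "y \<in> (\<lambda>h. h n) ` carrier (inverse_limit H p)" by blast
  qed
  then show thesis using that J(1) unfolding S_def by blast
qed

text \<open>A map killing the kernel of the projection to \<open>H n\<close> descends to the image of the limit in
  \<open>H n\<close> only; the Mittag-Leffler condition provides \<open>j > n\<close> such that \<open>H j\<close> maps into this image.\<close>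

lemma factors_through_projectionI:
  fixes H :: "nat \<Rightarrow> ('h, 'm) monoid_scheme"
  assumes H: "inverse_sequence H p" and ml: "mittag_leffler H p" and G: "group G"
    and \<phi>: "\<phi> \<in> hom (inverse_limit H p) G"
    and ker: "\<And>h. h \<in> carrier (inverse_limit H p) \<Longrightarrow> h n = \<one>\<^bsub>H n\<^esub> \<Longrightarrow> \<phi> h = \<one>\<^bsub>G\<^esub>"
  shows "factors_through_projection H p G \<phi>"
proof -
  let ?L = "inverse_limit H p"
  obtain j where j: "n < j" "p n j ` carrier (H j) \<subseteq> (\<lambda>h. h n) ` carrier ?L"
    using mittag_leffler_stable_image[OF H ml] .
  interpret L: group_hom ?L G \<phi>
    using group_inverse_limit[OF H] G \<phi> by (simp add: group_hom_def group_hom_axioms_def)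
  interpret Hn: group_hom ?L "H n" "\<lambda>h. h n"
    using H inverse_limit_projection_hom[of n H p] group_inverse_limit[OF H]
    by (simp add: group_hom_def group_hom_axioms_def inverse_sequence_def)
  have dep: "\<phi> h = \<phi> k" if h: "h \<in> carrier ?L" and k: "k \<in> carrier ?L" and eq: "h n = k n" for h k
  proof -
    have "(h \<otimes>\<^bsub>?L\<^esub> inv\<^bsub>?L\<^esub> k) n = \<one>\<^bsub>H n\<^esub>"
      using h k eq Hn.hom_mult[of h "inv\<^bsub>?L\<^esub> k"] Hn.hom_inv[of k] Hn.hom_closed[of k] by simp
    then have "\<phi> (h \<otimes>\<^bsub>?L\<^esub> inv\<^bsub>?L\<^esub> k) = \<one>\<^bsub>G\<^esub>"
      using h k by (intro ker L.G.m_closed) auto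
    then have "\<phi> h \<otimes>\<^bsub>G\<^esub> inv\<^bsub>G\<^esub> \<phi> k = \<one>\<^bsub>G\<^esub>"
      using h k L.hom_mult[of h "inv\<^bsub>?L\<^esub> k"] by simp
    then show ?thesis
      using h k by (metis L.H.inv_closed L.H.inv_equality L.H.inv_inv L.hom_closed)
  qed
  have "\<exists>y. y \<in> carrier ?L \<and> y n = p n j z" if "z \<in> carrier (H j)" for z
    using subsetD[OF j(2) imageI[OF that]] by (metis imageE)
  then obtain c where c: "\<And>z. z \<in> carrier (H j) \<Longrightarrow> c z \<in> carrier ?L \<and> c z n = p n j z" by metis
  have "(\<lambda>z. \<phi> (c z)) \<in> hom (H j) G"
  proof (rule homI)
    show "\<phi> (c z) \<in> carrier G" if "z \<in> carrier (H j)" for z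
      using c[OF that] by auto
    fix x y assume xy: "x \<in> carrier (H j)" "y \<in> carrier (H j)"
    then have m: "x \<otimes>\<^bsub>H j\<^esub> y \<in> carrier (H j)"
      using H by (simp add: inverse_sequence_def group.is_monoid monoid.m_closed)
    have "p n j (x \<otimes>\<^bsub>H j\<^esub> y) = p n j x \<otimes>\<^bsub>H n\<^esub> p n j y"
      using H j(1) xy by (auto simp: inverse_sequence_def hom_def)
    \<comment> \<open>The choice \<open>c\<close> need not be multiplicative, but both arguments
      agree in coordinate \<open>n\<close>, and \<open>\<phi>\<close> depends on nothing
      else.\<close>
    then have "\<phi> (c (x \<otimes>\<^bsub>H j\<^esub> y)) = \<phi> (c x \<otimes>\<^bsub>?L\<^esub> c y)"
      using c[OF m] c[OF xy(1)] c[OF xy(2)] L.G.m_closed[of "c x" "c y"] by (intro dep) auto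
    then show "\<phi> (c (x \<otimes>\<^bsub>H j\<^esub> y)) = \<phi> (c x) \<otimes>\<^bsub>G\<^esub> \<phi> (c y)"
      using c xy L.hom_mult by metis
  qed
  moreover have "\<phi> h = \<phi> (c (h j))" if h: "h \<in> carrier ?L" for h
  proof -
    have "h j \<in> carrier (H j)" "h n = p n j (h j)"
      using h j(1) by (auto simp: carrier_inverse_limit)
    then show ?thesis using c h by (intro dep) auto
  qed
  ultimately show ?thesis
    unfolding factors_through_projection_def by (intro exI[of _ j] bexI[of _ "\<lambda>z. \<phi> (c z)"]) auto
qed


section \<open>Generators of the limit of free groups\<close>

lemma mem_F_seq: "w \<in> carrier (F_seq i) \<longleftrightarrow> fst ` set w \<subseteq> {1..i} \<and> freely_reduced w"
  by (simp add: F_seq_def free_group_def)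

lemma one_F_seq [simp]: "\<one>\<^bsub>F_seq i\<^esub> = []"
  by (simp add: F_seq_def free_group_def)

lemma free_lift_cong:
  "(\<And>x. x \<in> fst ` set w \<Longrightarrow> f x = g x) \<Longrightarrow> free_lift G f w = free_lift G g w"
  by (induction w) auto

lemma group_F_hat: "group F_hat"
  unfolding F_hat_def by (rule group_inverse_limit[OF inverse_sequence_F])

text \<open>A reduced word in fewer generators is literally the same list in the larger free group.
  The bonding map agrees with the identity on the generators \<open>1..i\<close>, hence on all words
  in them.\<close>

lemma F_bond_id:
  assumes "i \<le> j" "w \<in> carrier (F_seq i)"
  shows "F_bond i j w = w"
proof -
  have "F_bond i j w = free_lift (F_seq i) (\<lambda>x. F_bond i j (free_gen x)) w"
    using assms by (intro free_lift_unique[OF group_F_seq])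
      (use F_bond_hom[of i j] in \<open>auto simp: mem_F_seq F_seq_def free_group_def\<close>)
  also have "\<dots> = free_lift (F_seq i) (\<lambda>x. id (free_gen x)) w"
    using assms by (intro free_lift_cong) (auto simp: mem_F_seq F_bond_gen)
  also have "\<dots> = id w"
    using assms(2) by (intro free_lift_unique[OF group_F_seq, symmetric])
      (auto simp: F_seq_def hom_def group_free_group group.is_monoid monoid.m_closed)
  finally show ?thesis by simp
qed


lemma F_bond_image:
  assumes "i \<le> j"
  shows "F_bond i j ` carrier (F_seq j) = carrier (F_seq i)"
proof
  show "carrier (F_seq i) \<subseteq> F_bond i j ` carrier (F_seq j)"
  proof
    fix w assume w: "w \<in> carrier (F_seq i)"
    then have "w \<in> carrier (F_seq j)"
      using assms by (auto simp: mem_F_seq)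
    then show "w \<in> F_bond i j ` carrier (F_seq j)"
      using F_bond_id[OF assms w] by (metis imageI)
  qed
qed (use hom_in_carrier[OF F_bond_hom] in blast)

lemma mittag_leffler_F: "mittag_leffler F_seq F_bond"
  unfolding mittag_leffler_def
proof
  fix i show "\<exists>j>i. \<forall>k\<ge>j. F_bond i k ` carrier (F_seq k) = F_bond i j ` carrier (F_seq j)"
    using F_bond_image by (intro exI[of _ "Suc i"]) auto
qed

text \<open>The generator is invisible in the coordinates below \<open>m\<close>. For
  \<open>m = 0\<close> the value lies outside \<open>F_hat\<close>, since generators are numbered
  from 1; hence the recurring condition \<open>1 \<le> m\<close>.\<close>

definition F_hat_gen :: "nat \<Rightarrow> nat \<Rightarrow> (nat \<times> bool) list" where
  "F_hat_gen m i = (if m \<le> i then free_gen m else [])"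

lemma F_hat_gen_closed:
  assumes "1 \<le> m"
  shows "F_hat_gen m \<in> carrier F_hat"
proof -
  have "free_gen m \<in> carrier (F_seq i)" if "m \<le> i" for i
    using assms that by (simp add: F_seq_def free_gen_in_carrier)
  then show ?thesis
    using assms hom_one[OF F_bond_hom group_F_seq group_F_seq] group.is_monoid[OF group_F_seq, THEN monoid.one_closed]
    by (auto simp: F_hat_def carrier_inverse_limit F_hat_gen_def F_bond_gen)
qed

section \<open>Homomorphisms from \<open>F_hat\<close> with prescribed images of the
  generators\<close>

definition F_hat_lift ::
    "(nat \<Rightarrow> ('h, 'm) monoid_scheme) \<Rightarrow> (nat \<Rightarrow> nat \<Rightarrow> 'h) \<Rightarrow> (nat \<Rightarrow> (nat \<times> bool) list) \<Rightarrow> nat \<Rightarrow> 'h" where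
  "F_hat_lift H h w = (\<lambda>i. free_lift (H i) (\<lambda>m. h m i) (w i))"

context
  fixes H :: "nat \<Rightarrow> ('h, 'm) monoid_scheme" and p h
  assumes H: "inverse_sequence H p"
    and h: "\<And>m. h m \<in> carrier (inverse_limit H p)" and h1: "\<And>m. h m m = \<one>\<^bsub>H m\<^esub>"
begin

text \<open>In each coordinate this is the universal map of a free group, so only coherence is at
  stake, and it can be checked on generators. A generator beyond \<open>i\<close> is killed by the
  bonding map to \<open>F_seq i\<close>; correspondingly \<open>h m i\<close> is trivial for
  \<open>i \<le> m\<close>, because \<open>h m\<close> is trivial in coordinate
  \<open>m\<close>.\<close>

lemma F_hat_lift_hom: "F_hat_lift H h \<in> hom F_hat (inverse_limit H p)"
proof -
  have gr: "group (H i)" for i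
    using H by (simp add: inverse_sequence_def)
  have hc: "h m i \<in> carrier (H i)" for m i
    using h by (simp add: carrier_inverse_limit)
  have lift: "free_lift (H i) (\<lambda>m. h m i) \<in> hom (F_seq j) (H i)" for i j
    unfolding F_seq_def by (rule free_lift_hom[OF gr]) (simp add: hc)
  have lift_gen: "free_lift (H i) (\<lambda>m. h m i) (free_gen m) = h m i" for i m
    using free_lift_gen[OF gr, of "\<lambda>m. h m i"] hc by simp
  have compat: "free_lift (H i) (\<lambda>m. h m i) (F_bond i j w) = p i j (free_lift (H j) (\<lambda>m. h m j) w)"
    if ij: "i < j" and w: "w \<in> carrier (F_seq j)" for i j w
  proof -
    have pij: "p i j \<in> hom (H j) (H i)"
      using H ij by (simp add: inverse_sequence_def)
    have "(free_lift (H i) (\<lambda>m. h m i) \<circ> F_bond i j) w =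
        free_lift (H i) (\<lambda>m. (free_lift (H i) (\<lambda>m. h m i) \<circ> F_bond i j) (free_gen m)) w"
      using w hom_compose[OF F_bond_hom[of i j] lift[of i i]] unfolding F_seq_def
      by (intro free_lift_unique[OF gr])
    also have "\<dots> = free_lift (H i) (\<lambda>m. (p i j \<circ> free_lift (H j) (\<lambda>m. h m j)) (free_gen m)) w"
    proof (rule free_lift_cong)
      fix m assume "m \<in> fst ` set w"
      then have m: "1 \<le> m" using w by (auto simp: mem_F_seq)
      have "h m i = p i j (h m j)"
        using h ij by (simp add: carrier_inverse_limit)
      moreover have "h m i = \<one>\<^bsub>H i\<^esub>" if "i \<le> m"
        using inverse_limit_one_below[OF H h h1 that] .
      ultimately show "(free_lift (H i) (\<lambda>m. h m i) \<circ> F_bond i j) (free_gen m) =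
          (p i j \<circ> free_lift (H j) (\<lambda>m. h m j)) (free_gen m)"
        using m by (auto simp: F_bond_gen lift_gen)
    qed
    also have "\<dots> = (p i j \<circ> free_lift (H j) (\<lambda>m. h m j)) w"
      using w hom_compose[OF lift[of j j] pij] unfolding F_seq_def
      by (intro free_lift_unique[OF gr, symmetric])
    finally show ?thesis by simp
  qed
  show ?thesis
  proof (rule homI)
    fix w assume "w \<in> carrier F_hat"
    then have w: "w i \<in> carrier (F_seq i)" "i < j \<Longrightarrow> w i = F_bond i j (w j)" for i j
      by (auto simp: F_hat_def carrier_inverse_limit)
    show "F_hat_lift H h w \<in> carrier (inverse_limit H p)"
      using compat w by (auto simp: carrier_inverse_limit F_hat_lift_def hom_in_carrier[OF lift w(1)])
  next
    fix v w assume "v \<in> carrier F_hat" "w \<in> carrier F_hat"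
    then have "v i \<in> carrier (F_seq i)" "w i \<in> carrier (F_seq i)" for i
      by (auto simp: F_hat_def carrier_inverse_limit)
    then show "F_hat_lift H h (v \<otimes>\<^bsub>F_hat\<^esub> w) =
        F_hat_lift H h v \<otimes>\<^bsub>inverse_limit H p\<^esub> F_hat_lift H h w"
      using hom_mult[OF lift] by (auto simp: F_hat_lift_def F_hat_def)
  qed
qed

lemma F_hat_lift_gen: "F_hat_lift H h (F_hat_gen m) = h m"
proof
  fix i
  have "h m i \<in> carrier (H i)" "group (H i)"
    using h H by (auto simp: carrier_inverse_limit inverse_sequence_def)
  moreover have "h m i = \<one>\<^bsub>H i\<^esub>" if "i \<le> m"
    using inverse_limit_one_below[OF H h h1 that] .
  ultimately show "F_hat_lift H h (F_hat_gen m) i = h m i"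
    by (simp add: F_hat_lift_def F_hat_gen_def free_lift_gen)
qed

lemma F_hat_lift_one:
  assumes "\<And>m. h m n = \<one>\<^bsub>H n\<^esub>"
  shows "F_hat_lift H h w n = \<one>\<^bsub>H n\<^esub>"
proof -
  have "group (H n)" using H by (simp add: inverse_sequence_def)
  then interpret group "H n" .
  have "free_lift (H n) (\<lambda>m. \<one>\<^bsub>H n\<^esub>) v = \<one>\<^bsub>H n\<^esub>" for v :: "('b \<times> bool) list"
    by (induction v) auto
  then show ?thesis by (simp add: F_hat_lift_def assms)
qed

end

section \<open>Slenderness tested on the generators of \<open>F_hat\<close>\<close>

text \<open>The analogue of the defining property of slender abelian groups; for abelian groups the role
  of \<open>F_hat\<close> is played by the product of countably many copies of the integers.\<close>

definition kills_generator :: "('g, 'n) monoid_scheme \<Rightarrow> bool" where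
  "kills_generator G \<longleftrightarrow> (\<forall>\<phi>\<in>hom F_hat G. \<exists>m\<ge>1. \<phi> (F_hat_gen m) = \<one>\<^bsub>G\<^esub>)"

lemma kills_generatorD:
  assumes G: "kills_generator G" and H: "inverse_sequence H p"
    and \<phi>: "\<phi> \<in> hom (inverse_limit H p) G"
    and h: "\<And>m. h m \<in> carrier (inverse_limit H p)" "\<And>m. h m m = \<one>\<^bsub>H m\<^esub>"
  shows "\<exists>m. \<phi> (h m) = \<one>\<^bsub>G\<^esub>"
proof -
  have "\<phi> \<circ> F_hat_lift H h \<in> hom F_hat G"
    by (rule hom_compose[OF F_hat_lift_hom[OF H h] \<phi>])
  then obtain m where "(\<phi> \<circ> F_hat_lift H h) (F_hat_gen m) = \<one>\<^bsub>G\<^esub>"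
    using G unfolding kills_generator_def by blast
  then show ?thesis
    using F_hat_lift_gen[OF H h] by auto
qed

text \<open>Strengthens one killed generator to a whole killed kernel, the form in which the
  hypothesis on a quotient or on the summands is applied below.\<close>

lemma kills_kernel:
  assumes G: "kills_generator G" and H: "inverse_sequence H p"
    and \<phi>: "\<phi> \<in> hom (inverse_limit H p) G"
  shows "\<exists>n. \<forall>h\<in>carrier (inverse_limit H p). h n = \<one>\<^bsub>H n\<^esub> \<longrightarrow> \<phi> h = \<one>\<^bsub>G\<^esub>"
proof (rule ccontr)
  assume "\<not> ?thesis"
  then obtain h where "\<And>n. h n \<in> carrier (inverse_limit H p) \<and> h n n = \<one>\<^bsub>H n\<^esub> \<and> \<phi> (h n) \<noteq> \<one>\<^bsub>G\<^esub>"
    by metis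
  then show False
    using kills_generatorD[OF G H \<phi>, of h] by blast
qed

lemma kills_generator_iff_factors:
  assumes "group G"
  shows "kills_generator G \<longleftrightarrow> (\<forall>\<phi>\<in>hom F_hat G. factors_through_projection F_seq F_bond G \<phi>)"
    (is "_ \<longleftrightarrow> ?R")
proof
  assume G: "kills_generator G"
  show ?R
  proof
    fix \<phi> assume \<phi>: "\<phi> \<in> hom F_hat G"
    then show "factors_through_projection F_seq F_bond G \<phi>"
      using kills_kernel[OF G inverse_sequence_F, of \<phi>] factors_through_projectionI[OF inverse_sequence_F mittag_leffler_F assms]
      unfolding F_hat_def by blast
  qed
next
  assume R: ?R
  show "kills_generator G"
    unfolding kills_generator_def
  proof
    fix \<phi> assume "\<phi> \<in> hom F_hat G"
    then obtain i \<psi> where \<psi>: "\<psi> \<in> hom (F_seq i) G" "\<And>w. w \<in> carrier F_hat \<Longrightarrow> \<phi> w = \<psi> (w i)"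
      using R unfolding factors_through_projection_def F_hat_def by blast
    \<comment> \<open>\<open>Suc i\<close> is the first index whose generator is trivial in
      coordinate \<open>i\<close>, and it is positive.\<close>
    have "\<phi> (F_hat_gen (Suc i)) = \<psi> \<one>\<^bsub>F_seq i\<^esub>"
      using \<psi>(2) F_hat_gen_closed by (simp add: F_hat_gen_def)
    also have "\<dots> = \<one>\<^bsub>G\<^esub>"
      by (rule hom_one[OF \<psi>(1) group_F_seq assms])
    finally show "\<exists>m\<ge>1. \<phi> (F_hat_gen m) = \<one>\<^bsub>G\<^esub>"
      by (intro exI[of _ "Suc i"]) simp
  qed
qed

lemma slenderI:
  assumes "group G" "kills_generator G"
  shows "inverse_limit_slender TYPE('h) G"
  unfolding inverse_limit_slender_def
proof (intro conjI allI impI ballI assms(1))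
  fix H :: "nat \<Rightarrow> 'h monoid" and p \<phi>
  assume H: "inverse_sequence H p" and ml: "mittag_leffler H p" and \<phi>: "\<phi> \<in> hom (inverse_limit H p) G"
  show "factors_through_projection H p G \<phi>"
    using kills_kernel[OF assms(2) H \<phi>] factors_through_projectionI[OF H ml assms(1) \<phi>] by blast
qed

text \<open>The definition tests only sequences over \<open>'h\<close>, whereas \<open>F_seq\<close>
  lives on words. There are countably many words, so they embed into the infinite type
  \<open>'h\<close>, and \<open>F_seq\<close> is copied along such an embedding \<open>e\<close>,
  with \<open>d\<close> leading back.\<close>

lemma slenderD:
  assumes inf: "infinite (UNIV :: 'h set)" and G: "inverse_limit_slender TYPE('h) G"
  shows "kills_generator G"
  unfolding kills_generator_def
proof
  fix \<phi> assume \<phi>: "\<phi> \<in> hom F_hat G"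
  have grG: "group G" using G by (simp add: inverse_limit_slender_def)
  obtain e :: "(nat \<times> bool) list \<Rightarrow> 'h" where e: "inj e"
  proof -
    obtain f :: "nat \<Rightarrow> 'h" where "inj f"
      using inf infinite_countable_subset by blast
    then have "inj (f \<circ> (to_nat :: (nat \<times> bool) list \<Rightarrow> nat))"
      by (simp add: inj_compose)
    then show ?thesis using that by blast
  qed
  then have e': "inj_on e A" for A by (rule inj_on_subset) simp
  define d where "d = Hilbert_Choice.inv e"
  have d [simp]: "d (e w) = w" for w using e by (simp add: d_def)
  define H where "H i = image_group e (F_seq i)" for i
  define p where "p i j = e \<circ> F_bond i j \<circ> d" for i j
  have carrier: "carrier (H i) = e ` carrier (F_seq i)" for i
    by (simp add: H_def image_group_def)
  have eH: "e \<in> hom (F_seq i) (H i)" for i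
    using inj_imp_image_group_iso[OF e'] by (auto simp: H_def iso_def)
  have dH: "d \<in> hom (H i) (F_seq i)" for i
    using inj_imp_image_group_inv_iso[OF e] by (auto simp: H_def iso_def d_def)
  have grH: "group (H i)" for i
    unfolding H_def by (rule group.inj_imp_image_group_is_group[OF group_F_seq e'])
  have H: "inverse_sequence H p"
    unfolding inverse_sequence_def
  proof (intro conjI allI impI ballI grH)
    show "p i j \<in> hom (H j) (H i)" for i j
      unfolding p_def using hom_compose[OF hom_compose[OF dH F_bond_hom] eH] by (simp add: comp_assoc)
    show "p i j (p j k x) = p i k x" if "i < j" "j < k" "x \<in> carrier (H k)" for i j k x
      using that inverse_sequence_F by (auto simp: p_def carrier inverse_sequence_def)
  qed
  have "mittag_leffler H p"
    unfolding mittag_leffler_def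
  proof (intro allI exI conjI impI)
    fix i k :: nat assume "Suc i \<le> k"
    have "p i k ` carrier (H k) = carrier (H i)" if "i < k" for k
      using F_bond_image[of i k] that by (simp add: p_def carrier image_comp comp_def flip: image_image)
    then show "p i k ` carrier (H k) = p i (Suc i) ` carrier (H (Suc i))"
      using \<open>Suc i \<le> k\<close> by simp
  qed simp
  moreover have "\<phi> \<circ> (\<lambda>h i. d (h i)) \<in> hom (inverse_limit H p) G"
  proof (rule hom_compose[OF _ \<phi>])
    show "(\<lambda>h i. d (h i)) \<in> hom (inverse_limit H p) F_hat"
    proof (rule homI)
      fix h assume h: "h \<in> carrier (inverse_limit H p)"
      then have "d (h i) = d (p i j (h j))" if "i < j" for i j
        using that by (auto simp: carrier_inverse_limit)
      then show "(\<lambda>i. d (h i)) \<in> carrier F_hat"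
        using h hom_in_carrier[OF dH] by (auto simp: F_hat_def carrier_inverse_limit p_def)
    qed (auto simp: F_hat_def carrier_inverse_limit hom_mult[OF dH])
  qed
  ultimately have "factors_through_projection H p G (\<phi> \<circ> (\<lambda>h i. d (h i)))"
    using G H unfolding inverse_limit_slender_def by blast
  then obtain i \<psi> where \<psi>: "\<psi> \<in> hom (H i) G"
    "\<And>h. h \<in> carrier (inverse_limit H p) \<Longrightarrow> \<phi> (\<lambda>i. d (h i)) = \<psi> (h i)"
    unfolding factors_through_projection_def by auto
  have "F_hat_gen (Suc i) \<in> carrier F_hat" by (rule F_hat_gen_closed) simp
  then have "(\<lambda>j. e (F_hat_gen (Suc i) j)) \<in> carrier (inverse_limit H p)"
    by (auto simp: F_hat_def carrier_inverse_limit carrier p_def)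
  from \<psi>(2)[OF this] have "\<phi> (F_hat_gen (Suc i)) = \<psi> (e (F_hat_gen (Suc i) i))"
    by simp
  also have "\<dots> = \<psi> (e \<one>\<^bsub>F_seq i\<^esub>)"
    by (simp add: F_hat_gen_def)
  also have "\<dots> = \<one>\<^bsub>G\<^esub>"
    using hom_one[OF eH group_F_seq grH] hom_one[OF \<psi>(1) grH grG] by simp
  finally show "\<exists>m\<ge>1. \<phi> (F_hat_gen m) = \<one>\<^bsub>G\<^esub>"
    by (intro exI[of _ "Suc i"]) simp
qed


text \<open>The right-hand side does not mention \<open>'h\<close>, so all infinite test types give
  the same notion.\<close>

lemma slender_iff_kills_generator:
  assumes "infinite (UNIV :: 'h set)"
  shows "inverse_limit_slender TYPE('h) G \<longleftrightarrow> group G \<and> kills_generator G"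
proof -
  have "group G" if "inverse_limit_slender TYPE('h) G"
    using that by (simp add: inverse_limit_slender_def)
  then show ?thesis using slenderI slenderD[OF assms] by blast
qed


section \<open>Closure properties\<close>

lemma kills_generator_subgroup:
  assumes "group G" "kills_generator G" "subgroup A G"
  shows "kills_generator (G\<lparr>carrier := A\<rparr>)"
  unfolding kills_generator_def
proof
  fix \<phi> assume "\<phi> \<in> hom F_hat (G\<lparr>carrier := A\<rparr>)"
  then have "\<phi> \<in> hom F_hat G"
    using subgroup.subset[OF assms(3)] by (auto simp: hom_def)
  then show "\<exists>m\<ge>1. \<phi> (F_hat_gen m) = \<one>\<^bsub>G\<lparr>carrier := A\<rparr>\<^esub>"
    using assms(2) by (auto simp: kills_generator_def)
qed

text \<open>The shift of generators by \<open>n\<close> is an endomorphism of \<open>F_hat\<close> with values in the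
  kernel of the projection to \<open>F_seq n\<close>.\<close>

lemma kills_generator_extension:
  assumes \<pi>: "\<pi> \<in> hom G Q" and Q: "kills_generator Q"
    and K: "kills_generator (G\<lparr>carrier := kernel G Q \<pi>\<rparr>)"
  shows "kills_generator G"
  unfolding kills_generator_def
proof
  fix \<phi> assume \<phi>: "\<phi> \<in> hom F_hat G"
  have "\<pi> \<circ> \<phi> \<in> hom (inverse_limit F_seq F_bond) Q"
    using hom_compose[OF \<phi> \<pi>] by (simp add: F_hat_def)
  from kills_kernel[OF Q inverse_sequence_F this]
  obtain n where n: "\<And>w. w \<in> carrier F_hat \<Longrightarrow> w n = [] \<Longrightarrow> \<pi> (\<phi> w) = \<one>\<^bsub>Q\<^esub>"
    by (auto simp: F_hat_def)
  \<comment> \<open>The index exceeds \<open>m\<close>, so that \<open>F_hat_lift\<close> applies to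
    \<open>h\<close>, and exceeds \<open>n\<close>, so that the lifted elements lie in the kernel of
    the projection to \<open>F_seq n\<close>.\<close>
  define h where "h m = F_hat_gen (Suc (m + n))" for m
  have h: "\<And>m. h m \<in> carrier (inverse_limit F_seq F_bond)" "\<And>m. h m m = \<one>\<^bsub>F_seq m\<^esub>"
    "\<And>m. h m n = \<one>\<^bsub>F_seq n\<^esub>"
    using F_hat_gen_closed by (simp_all add: h_def F_hat_def F_hat_gen_def)
  note lift = F_hat_lift_hom[OF inverse_sequence_F h(1,2)]
  have "\<phi> \<circ> F_hat_lift F_seq h \<in> hom F_hat (G\<lparr>carrier := kernel G Q \<pi>\<rparr>)"
  proof (rule homI)
    fix w assume "w \<in> carrier F_hat"
    then have "F_hat_lift F_seq h w \<in> carrier F_hat"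
      using hom_in_carrier[OF lift] by (simp add: F_hat_def)
    then show "(\<phi> \<circ> F_hat_lift F_seq h) w \<in> carrier (G\<lparr>carrier := kernel G Q \<pi>\<rparr>)"
      using n F_hat_lift_one[OF inverse_sequence_F h(1,2), of n w] h(3) hom_in_carrier[OF \<phi>] by (simp add: kernel_def)
  next
    fix v w assume "v \<in> carrier F_hat" "w \<in> carrier F_hat"
    then show "(\<phi> \<circ> F_hat_lift F_seq h) (v \<otimes>\<^bsub>F_hat\<^esub> w) =
        (\<phi> \<circ> F_hat_lift F_seq h) v \<otimes>\<^bsub>G\<lparr>carrier := kernel G Q \<pi>\<rparr>\<^esub> (\<phi> \<circ> F_hat_lift F_seq h) w"
      using hom_mult[OF hom_compose[OF lift \<phi>[unfolded F_hat_def]]] by (simp add: F_hat_def)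
  qed
  then obtain m where "\<phi> (F_hat_lift F_seq h (F_hat_gen m)) = \<one>\<^bsub>G\<^esub>"
    using K unfolding kills_generator_def by auto
  then show "\<exists>m\<ge>1. \<phi> (F_hat_gen m) = \<one>\<^bsub>G\<^esub>"
    using F_hat_lift_gen[OF inverse_sequence_F h(1,2), of m]
    by (intro exI[of _ "Suc (m + n)"]) (simp add: h_def)
qed

text \<open>The recursion from \<open>n\<close> to \<open>Suc n\<close> never ends in
  \<open>F_hat\<close>, but in coordinate \<open>i\<close> it stops once \<open>n\<close> exceeds
  \<open>i\<close>. Large exponents \<open>k\<close> serve Higman's argument; \<open>k = 1\<close>
  with exponents \<open>e\<close> in {0, 1} gives an infinite product of selected
  generators.\<close>

lemma F_hat_infinite_word:
  fixes e k :: "nat \<Rightarrow> nat"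
  obtains u where "\<And>n. 1 \<le> n \<Longrightarrow> u n \<in> carrier F_hat"
    "\<And>n. 1 \<le> n \<Longrightarrow> u n = F_hat_gen n [^]\<^bsub>F_hat\<^esub> e n \<otimes>\<^bsub>F_hat\<^esub> u (Suc n) [^]\<^bsub>F_hat\<^esub> k n"
    "\<And>n i. i < n \<Longrightarrow> u n i = []"
proof -
  \<comment> \<open>\<open>V i d\<close> is coordinate \<open>i\<close> of the word with index
    \<open>Suc i - d\<close>, computed downwards from the trivial one with index
    \<open>Suc i\<close>.\<close>
  define V where "V i = rec_nat [] (\<lambda>d v. F_hat_gen (i - d) i [^]\<^bsub>F_seq i\<^esub> e (i - d) \<otimes>\<^bsub>F_seq i\<^esub>
      v [^]\<^bsub>F_seq i\<^esub> k (i - d))" for i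
  define u where "u n i = V i (Suc i - n)" for n i
  have u1: "u n i = []" if "i < n" for n i
    using that by (simp add: u_def V_def)
  have u2: "u n i = F_hat_gen n i [^]\<^bsub>F_seq i\<^esub> e n \<otimes>\<^bsub>F_seq i\<^esub> u (Suc n) i [^]\<^bsub>F_seq i\<^esub> k n" for n i
  proof (cases "n \<le> i")
    case True
    then show ?thesis by (simp add: u_def V_def Suc_diff_le)
  next
    case False
    interpret group "F_seq i" by (rule group_F_seq)
    show ?thesis
      using False nat_pow_one l_one[OF one_closed] by (simp add: u1 F_hat_gen_def)
  qed
  have gen: "F_hat_gen n i \<in> carrier (F_seq i)" "i < j \<Longrightarrow> F_hat_gen n i = F_bond i j (F_hat_gen n j)"
    if "1 \<le> n" for n i j
    using F_hat_gen_closed[OF that] by (simp_all add: F_hat_def carrier_inverse_limit)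
  have closed: "u n i \<in> carrier (F_seq i)" if "1 \<le> n" for n i
    using that
  proof (induction "Suc i - n" arbitrary: n)
    case 0
    then show ?case using u1[of i n] by (simp add: mem_F_seq)
  next
    case (Suc d)
    interpret group "F_seq i" by (rule group_F_seq)
    show ?case
      unfolding u2[of n i] using Suc gen(1) by (intro m_closed nat_pow_closed) auto
  qed
  have compat: "u n i = F_bond i j (u n j)" if "1 \<le> n" "i < j" for n i j
    using that
  proof (induction "Suc j - n" arbitrary: n)
    case 0
    then show ?case
      using u1[of i n] u1[of j n] hom_one[OF F_bond_hom group_F_seq group_F_seq] by simp
  next
    case (Suc d)
    interpret group_hom "F_seq j" "F_seq i" "F_bond i j"
      by (simp add: group_hom_def group_hom_axioms_def group_F_seq F_bond_hom)
    have "u (Suc n) i = F_bond i j (u (Suc n) j)"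
      using Suc by simp
    moreover have "F_hat_gen n i = F_bond i j (F_hat_gen n j)"
      by (rule gen(2)[OF Suc.prems])
    moreover have "u (Suc n) j \<in> carrier (F_seq j)" "F_hat_gen n j \<in> carrier (F_seq j)"
      using closed[of "Suc n" j] gen(1)[OF Suc.prems(1), of j] by auto
    ultimately show ?case
      unfolding u2[of n i] u2[of n j] by (simp only: hom_nat_pow hom_mult G.nat_pow_closed)
  qed
  show thesis
  proof (rule that)
    show "u n \<in> carrier F_hat" if "1 \<le> n" for n
      using closed[OF that] compat[OF that] by (simp add: F_hat_def carrier_inverse_limit)
    show "u n = F_hat_gen n [^]\<^bsub>F_hat\<^esub> e n \<otimes>\<^bsub>F_hat\<^esub> u (Suc n) [^]\<^bsub>F_hat\<^esub> k n" for n
      using u2[of n] by (simp add: F_hat_def fun_eq_iff)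
  qed (rule u1)
qed

section \<open>Groups with a length function growing under powers\<close>

text \<open>Higman's argument: if no generator is killed, the images \<open>a n\<close> of the words given by
  \<open>u n = F_hat_gen n \<otimes> u (n + 1) ^ k n\<close> are nontrivial and have strictly decreasing length
  as soon as the exponents \<open>k n\<close> exceed the lengths of the inverses of the generators' images.\<close>

lemma kills_generator_length:
  fixes len :: "'g \<Rightarrow> nat"
  assumes "group G"
    and one: "len \<one>\<^bsub>G\<^esub> = 0"
    and mult: "\<And>x y. x \<in> carrier G \<Longrightarrow> y \<in> carrier G \<Longrightarrow> len (x \<otimes>\<^bsub>G\<^esub> y) \<le> len x + len y"
    and pow: "\<And>x n. x \<in> carrier G \<Longrightarrow> x \<noteq> \<one>\<^bsub>G\<^esub> \<Longrightarrow> len x + n \<le> len (x [^]\<^bsub>G\<^esub> Suc n)"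
  shows "kills_generator G"
  unfolding kills_generator_def
proof (rule ballI, rule ccontr)
  fix \<phi> assume \<phi>: "\<phi> \<in> hom F_hat G" and "\<not> (\<exists>m\<ge>1. \<phi> (F_hat_gen m) = \<one>\<^bsub>G\<^esub>)"
  then have nt: "\<phi> (F_hat_gen n) \<noteq> \<one>\<^bsub>G\<^esub>" if "1 \<le> n" for n
    using that by blast
  interpret group_hom F_hat G \<phi>
    using \<phi> assms(1) group_F_hat by (simp add: group_hom_def group_hom_axioms_def)
  define g where "g n = \<phi> (F_hat_gen n)" for n
  obtain u where u: "\<And>n. 1 \<le> n \<Longrightarrow> u n \<in> carrier F_hat"
    "\<And>n. 1 \<le> n \<Longrightarrow> u n = F_hat_gen n [^]\<^bsub>F_hat\<^esub> (1 :: nat) \<otimes>\<^bsub>F_hat\<^esub> u (Suc n) [^]\<^bsub>F_hat\<^esub> Suc (Suc (len (inv\<^bsub>G\<^esub> g n)))"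
    "\<And>n i. i < n \<Longrightarrow> u n i = []"
    by (rule F_hat_infinite_word[of "\<lambda>n. 1" "\<lambda>n. Suc (Suc (len (inv\<^bsub>G\<^esub> g n)))"]) (rule that)
  define a where "a n = \<phi> (u n)" for n
  have a: "a n \<in> carrier G" and g: "g n \<in> carrier G" if "1 \<le> n" for n
    using u(1) F_hat_gen_closed that by (auto simp: a_def g_def)
  have a_rec: "a n = g n \<otimes>\<^bsub>G\<^esub> a (Suc n) [^]\<^bsub>G\<^esub> Suc (Suc (len (inv\<^bsub>G\<^esub> g n)))" if "1 \<le> n" for n
  proof -
    have "a n = \<phi> (F_hat_gen n \<otimes>\<^bsub>F_hat\<^esub> u (Suc n) [^]\<^bsub>F_hat\<^esub> Suc (Suc (len (inv\<^bsub>G\<^esub> g n))))"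
      using u(2)[OF that] F_hat_gen_closed[OF that] by (simp add: a_def)
    then show ?thesis
      using u(1)[of "Suc n"] F_hat_gen_closed[OF that]
      by (simp add: a_def g_def hom_nat_pow del: nat_pow_Suc)
  qed
  \<comment> \<open>The exponent exceeds 1 by \<open>Suc (len (inv g n))\<close>: the length of
    \<open>inv g n\<close> pays for the possible loss when \<open>g n\<close> is multiplied on, and
    the extra 1 makes the decrease strict.\<close>
  have dec: "len (a (Suc n)) < len (a n)" if n: "1 \<le> n" and nontriv: "a (Suc n) \<noteq> \<one>\<^bsub>G\<^esub>" for n
  proof -
    define b where "b = a (Suc n) [^]\<^bsub>G\<^esub> Suc (Suc (len (inv\<^bsub>G\<^esub> g n)))"
    have b: "b \<in> carrier G"
      unfolding b_def using a[of "Suc n"] by (intro H.nat_pow_closed) simp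
    have "inv\<^bsub>G\<^esub> g n \<otimes>\<^bsub>G\<^esub> a n = b"
      using g[OF n] b a_rec[OF n, folded b_def] by (simp flip: H.m_assoc)
    then have "len b \<le> len (inv\<^bsub>G\<^esub> g n) + len (a n)"
      using mult[of "inv\<^bsub>G\<^esub> g n" "a n"] a[OF n] g[OF n] by simp
    moreover have "len (a (Suc n)) + Suc (len (inv\<^bsub>G\<^esub> g n)) \<le> len b"
      unfolding b_def using a[of "Suc n"] nontriv by (intro pow) simp_all
    ultimately show ?thesis by simp
  qed
  have "a n \<noteq> \<one>\<^bsub>G\<^esub>" if n: "1 \<le> n" for n
  proof (cases "a (Suc n) = \<one>\<^bsub>G\<^esub>")
    case True
    then have "a n = g n" using a_rec[OF n] g[OF n] by simp
    then show ?thesis using nt[OF n] by (simp add: g_def)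
  next
    case False
    then show ?thesis using dec[OF n] one by auto
  qed
  then have "len (a (Suc (Suc n))) < len (a (Suc n))" for n
    using dec[of "Suc n"] by simp
  then show False
    using wf_no_infinite_down_chainE[OF wf_measure[of len], of "\<lambda>n. a (Suc n)"] by auto
qed


text \<open>Each coordinate \<open>l\<close> of \<open>\<phi>\<close> factors its triviality through
  a stage \<open>N l\<close>: it kills everything trivial there. Choosing indices \<open>m k\<close>
  that grow fast enough gives coordinates \<open>l k\<close> in which \<open>F_hat_gen (m k)\<close>
  has nontrivial image while the other chosen generators have trivial image. The image of the
  infinite product of the chosen generators is then nontrivial at every \<open>l k\<close>,
  contradicting finite support.\<close>

lemma kills_generator_sum_group:
  assumes gr: "\<And>l. l \<in> I \<Longrightarrow> group (G l)" and kills: "\<And>l. l \<in> I \<Longrightarrow> kills_generator (G l)"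
  shows "kills_generator (sum_group I G)"
  unfolding kills_generator_def
proof (rule ballI, rule ccontr)
  fix \<phi> assume \<phi>: "\<phi> \<in> hom F_hat (sum_group I G)"
    and "\<not> (\<exists>m\<ge>1. \<phi> (F_hat_gen m) = \<one>\<^bsub>sum_group I G\<^esub>)"
  then have nt: "\<phi> (F_hat_gen n) \<noteq> \<one>\<^bsub>sum_group I G\<^esub>" if "1 \<le> n" for n
    using that by blast
  define supp where "supp x = {l \<in> I. x l \<noteq> \<one>\<^bsub>G l\<^esub>}" for x
  have \<phi>_mem: "\<phi> w \<in> (\<Pi>\<^sub>E l\<in>I. carrier (G l))" "finite (supp (\<phi> w))" if "w \<in> carrier F_hat" for w
    using hom_in_carrier[OF \<phi> that] gr by (simp_all add: carrier_sum_group supp_def)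
  have coord: "(\<lambda>w. \<phi> w l) \<in> hom F_hat (G l)" if l: "l \<in> I" for l
  proof (rule homI)
    show "\<phi> w l \<in> carrier (G l)" if "w \<in> carrier F_hat" for w
      using \<phi>_mem(1)[OF that] l by auto
    show "\<phi> (v \<otimes>\<^bsub>F_hat\<^esub> w) l = \<phi> v l \<otimes>\<^bsub>G l\<^esub> \<phi> w l"
      if "v \<in> carrier F_hat" "w \<in> carrier F_hat" for v w
      using hom_mult[OF \<phi> that] l by simp
  qed
  have "\<exists>n. \<forall>w\<in>carrier F_hat. w n = [] \<longrightarrow> \<phi> w l = \<one>\<^bsub>G l\<^esub>" if "l \<in> I" for l
    using kills_kernel[OF kills[OF that] inverse_sequence_F, of "\<lambda>w. \<phi> w l"] coord[OF that]
    by (simp add: F_hat_def)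
  then obtain N where N: "\<And>l w. l \<in> I \<Longrightarrow> w \<in> carrier F_hat \<Longrightarrow> w (N l) = [] \<Longrightarrow> \<phi> w l = \<one>\<^bsub>G l\<^esub>"
    by metis
  \<comment> \<open>The next index must exceed \<open>n\<close> itself and the stages of all
    coordinates in the support for generator \<open>n\<close>. Including \<open>n\<close> also keeps
    the set nonempty for \<open>Max\<close>.\<close>
  define M where "M n = Suc (Max (insert n (N ` supp (\<phi> (F_hat_gen n)))))" for n
  have fin: "finite (insert n (N ` supp (\<phi> (F_hat_gen n))))" if "1 \<le> n" for n
    using \<phi>_mem(2)[OF F_hat_gen_closed[OF that]] by simp
  have M: "n < M n" "l \<in> supp (\<phi> (F_hat_gen n)) \<Longrightarrow> N l < M n" if "1 \<le> n" for n l
    using Max_ge[OF fin[OF that], of n] Max_ge[OF fin[OF that], of "N l"]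
    by (auto simp: M_def less_Suc_eq_le)
  define m where "m k = (M ^^ k) 1" for k
  have m1: "1 \<le> m k" for k
  proof (induction k)
    case (Suc k)
    then show ?case using M(1)[of "m k"] by (simp add: m_def)
  qed (simp add: m_def)
  have mS: "m (Suc k) = M (m k)" for k by (simp add: m_def)
  have mono: "strict_mono m"
    using M(1)[OF m1] by (simp add: strict_mono_Suc_iff mS)
  have "\<exists>l. l \<in> supp (\<phi> (F_hat_gen (m k)))" for k
  proof (rule ccontr)
    assume "\<nexists>l. l \<in> supp (\<phi> (F_hat_gen (m k)))"
    then have "\<phi> (F_hat_gen (m k)) = \<one>\<^bsub>sum_group I G\<^esub>"
      using \<phi>_mem(1)[OF F_hat_gen_closed[OF m1]]
      by (intro PiE_ext[where k = I and s = "\<lambda>l. carrier (G l)"])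
        (auto simp: supp_def gr group.is_monoid)
    then show False using nt[OF m1] by blast
  qed
  then obtain l where l: "\<And>k. l k \<in> supp (\<phi> (F_hat_gen (m k)))" by metis
  then have lI: "l k \<in> I" for k by (auto simp: supp_def)
  have Nl: "N (l k) < m (Suc k)" for k
    using M(2)[OF m1 l] by (simp add: mS)
  \<comment> \<open>If an earlier chosen generator were visible in \<open>l k\<close>, the stage of
    \<open>l k\<close> would lie below \<open>m k\<close>, and generator \<open>m k\<close> would be
    killed there.\<close>
  have fresh: "\<phi> (F_hat_gen (m j)) (l k) = \<one>\<^bsub>G (l k)\<^esub>" if "j < k" for j k
  proof (rule ccontr)
    assume "\<not> ?thesis"
    then have "l k \<in> supp (\<phi> (F_hat_gen (m j)))" using lI by (simp add: supp_def)
    then have "N (l k) < m (Suc j)" using M(2)[OF m1] by (simp add: mS)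
    also have "m (Suc j) \<le> m k" using mono that by (simp add: strict_mono_less_eq)
    finally have "\<phi> (F_hat_gen (m k)) (l k) = \<one>\<^bsub>G (l k)\<^esub>"
      using N[OF lI F_hat_gen_closed[OF m1]] by (simp add: F_hat_gen_def)
    then show False using l[of k] by (simp add: supp_def)
  qed
  \<comment> \<open>With these exponents \<open>u 1\<close> is the infinite product of the
    generators \<open>F_hat_gen (m k)\<close> in increasing order.\<close>
  obtain u where u: "\<And>n. 1 \<le> n \<Longrightarrow> u n \<in> carrier F_hat"
    "\<And>n. 1 \<le> n \<Longrightarrow> u n = F_hat_gen n [^]\<^bsub>F_hat\<^esub> (of_bool (n \<in> range m) :: nat) \<otimes>\<^bsub>F_hat\<^esub>
      u (Suc n) [^]\<^bsub>F_hat\<^esub> (1 :: nat)"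
    "\<And>n i. i < n \<Longrightarrow> u n i = []"
    by (rule F_hat_infinite_word[of "\<lambda>n. of_bool (n \<in> range m)" "\<lambda>n. 1"]) (rule that)
  interpret F: group F_hat by (rule group_F_hat)
  have step: "\<phi> (u n) i = (if n \<in> range m then \<phi> (F_hat_gen n) i else \<one>\<^bsub>G i\<^esub>) \<otimes>\<^bsub>G i\<^esub> \<phi> (u (Suc n)) i"
    if "1 \<le> n" "i \<in> I" for n i
  proof -
    interpret Gi: group "G i" using that by (intro gr)
    have c: "u (Suc n) \<in> carrier F_hat" "F_hat_gen n \<in> carrier F_hat"
      using u(1) F_hat_gen_closed that by simp_all
    have "\<phi> (u (Suc n)) i \<in> carrier (G i)"
      using hom_in_carrier[OF coord[OF that(2)] c(1)] .
    then show ?thesis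
      using u(2)[OF that(1)] hom_mult[OF coord[OF that(2)] c(2,1)] c by auto
  qed
  have skip: "\<phi> (u n) i = \<phi> (u (n + d)) i"
    if "1 \<le> n" "i \<in> I"
      "\<And>j. n \<le> m j \<Longrightarrow> m j < n + d \<Longrightarrow> \<phi> (F_hat_gen (m j)) i = \<one>\<^bsub>G i\<^esub>" for n d i
    using that(3)
  proof (induction d)
    case (Suc d)
    interpret Gi: group "G i" using that by (intro gr)
    have "\<phi> (u (Suc (n + d))) i \<in> carrier (G i)"
      using hom_in_carrier[OF coord[OF that(2)] u(1)] by simp
    moreover have "\<phi> (F_hat_gen (n + d)) i = \<one>\<^bsub>G i\<^esub>" if "n + d \<in> range m"
      using Suc.prems that by (metis imageE le_add1 lessI add_Suc_right)
    ultimately have "\<phi> (u (n + d)) i = \<phi> (u (n + Suc d)) i"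
      using step[of "n + d" i] that by auto
    then show ?case using Suc by simp
  qed simp
  \<comment> \<open>In coordinate \<open>l k\<close>, the factors before \<open>m k\<close> vanish
    by \<open>fresh\<close>, none is selected between \<open>m k\<close> and
    \<open>m (Suc k)\<close>, and the whole tail from there on is trivial at stage
    \<open>N (l k)\<close>.\<close>
  have "l k \<in> supp (\<phi> (u 1))" for k
  proof -
    interpret Gl: group "G (l k)" by (rule gr[OF lI])
    have "\<phi> (u 1) (l k) = \<phi> (u (1 + (m k - 1))) (l k)"
      using m1[of k] mono by (intro skip lI fresh) (auto simp: strict_mono_less)
    also have "\<dots> = \<phi> (u (m k)) (l k)"
      using m1[of k] by simp
    also have "\<dots> = \<phi> (F_hat_gen (m k)) (l k) \<otimes>\<^bsub>G (l k)\<^esub> \<phi> (u (Suc (m k))) (l k)"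
      using step[OF m1 lI] by simp
    also have "\<phi> (u (Suc (m k))) (l k) = \<phi> (u (Suc (m k) + (m (Suc k) - Suc (m k)))) (l k)"
    proof (rule skip[OF _ lI])
      fix j assume j: "Suc (m k) \<le> m j" "m j < Suc (m k) + (m (Suc k) - Suc (m k))"
      then have "m k < m j" "m j < m (Suc k)" by auto
      then show "\<phi> (F_hat_gen (m j)) (l k) = \<one>\<^bsub>G (l k)\<^esub>"
        using mono by (simp add: strict_mono_less)
    qed simp
    also have "Suc (m k) + (m (Suc k) - Suc (m k)) = m (Suc k)"
      using strict_monoD[OF mono, of k "Suc k"] by simp
    also have "\<phi> (u (m (Suc k))) (l k) = \<one>\<^bsub>G (l k)\<^esub>"
      by (rule N[OF lI u(1)[OF m1] u(3)[OF Nl]])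
    finally show ?thesis
      using l[of k] lI hom_in_carrier[OF coord[OF lI] F_hat_gen_closed[OF m1]]
      by (simp add: supp_def)
  qed
  then have "range l \<subseteq> supp (\<phi> (u 1))" by blast
  moreover have "inj l"
  proof (rule linorder_injI)
    fix j k :: nat assume "j < k"
    then show "l j \<noteq> l k"
      using fresh[of j k] l[of j] by (auto simp: supp_def)
  qed
  ultimately show False
    using finite_subset[OF _ \<phi>_mem(2)[OF u(1)[of 1]]] range_inj_infinite by blast
qed


section \<open>Free products\<close>

lemma (in group) conj_nat_pow:
  assumes "x \<in> carrier G" "y \<in> carrier G"
  shows "(x \<otimes> y \<otimes> inv x) [^] (n :: nat) = x \<otimes> y [^] n \<otimes> inv x"
proof (induction n)
  case (Suc n)
  have "x \<otimes> y [^] n \<otimes> inv x \<otimes> (x \<otimes> y \<otimes> inv x) = x \<otimes> y [^] n \<otimes> (inv x \<otimes> x) \<otimes> y \<otimes> inv x"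
    using assms by (simp only: m_assoc m_closed inv_closed nat_pow_closed)
  also have "\<dots> = x \<otimes> y [^] Suc n \<otimes> inv x"
    using assms by (simp add: m_assoc)
  finally show ?case using Suc by simp
qed (use assms in simp)

lemma mult_free_product: "u \<otimes>\<^bsub>free_product I G\<^esub> v = foldr (free_product_cons G) u v"
  by (simp add: free_product_def)

lemma one_free_product: "\<one>\<^bsub>free_product I G\<^esub> = []"
  by (simp add: free_product_def)

lemma free_product_append:
  "u @ v \<in> carrier (free_product I G) \<longleftrightarrow>
     u \<in> carrier (free_product I G) \<and> v \<in> carrier (free_product I G) \<and>
     (u = [] \<or> v = [] \<or> fst (last u) \<noteq> fst (hd v))"
  by (auto simp: free_product_def successively_append_iff)

lemma mult_free_product_append:
  "u @ v \<in> carrier (free_product I G) \<Longrightarrow> u \<otimes>\<^bsub>free_product I G\<^esub> v = u @ v"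
proof (induction u)
  case (Cons a u)
  then show ?case
    using free_product_cons_reduced[of a "u @ v" I G] by (simp add: mult_free_product free_product_Cons)
qed (simp add: mult_free_product)

lemma length_mult_free_product: "length (u \<otimes>\<^bsub>free_product I G\<^esub> v) \<le> length u + length v"
proof -
  have "length (free_product_cons G a w) \<le> Suc (length w)" for a w
    by (cases w) auto
  then show ?thesis
    unfolding mult_free_product by (induction u) (auto intro: order_trans)
qed

section \<open>Projections onto the factors and powers of words\<close>

definition free_product_proj :: "('l \<Rightarrow> ('g, 'n) monoid_scheme) \<Rightarrow> 'l \<Rightarrow> ('l \<times> 'g) list \<Rightarrow> 'g" where
  "free_product_proj G l = free_product_lift (G l) (\<lambda>m g. if m = l then g else \<one>\<^bsub>G l\<^esub>)"

context
  fixes I :: "'l set" and G :: "'l \<Rightarrow> ('g, 'n) monoid_scheme"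
  assumes groups: "\<And>l. l \<in> I \<Longrightarrow> group (G l)"
begin

interpretation FP: group "free_product I G"
  by (rule group_free_product[OF groups])

lemma free_product_proj_hom:
  assumes "l \<in> I"
  shows "free_product_proj G l \<in> hom (free_product I G) (G l)"
  unfolding free_product_proj_def
proof (rule free_product_lift_hom[OF groups])
  interpret group "G l" using assms by (rule groups)
  show "(\<lambda>g. if m = l then g else \<one>\<^bsub>G l\<^esub>) \<in> hom (G m) (G l)" for m
    by (auto simp: hom_def)
qed (use assms groups in auto)

lemma free_product_proj_singleton:
  assumes "l \<in> I" "g \<in> carrier (G l)"
  shows "free_product_proj G l [(l, g)] = g"
  using assms groups[OF assms(1)]
  by (simp add: free_product_proj_def free_product_lift_def group.is_monoid)

text \<open>Consecutive copies of \<open>w\<close> meet in letters of different factors, so nothing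
  cancels or merges. The form \<open>s @ w\<close> keeps the last letter accessible, which changes
  when a conjugation is undone.\<close>

lemma free_product_pow_cyclically_reduced:
  assumes w: "w \<in> carrier (free_product I G)" "w \<noteq> []" "fst (hd w) \<noteq> fst (last w)"
  shows "\<exists>s. w [^]\<^bsub>free_product I G\<^esub> Suc n = s @ w \<and> length s = n * length w \<and> hd (s @ w) = hd w"
proof (induction n)
  case 0
  then show ?case using w by simp
next
  case (Suc n)
  then obtain s where s: "w [^]\<^bsub>free_product I G\<^esub> Suc n = s @ w" "length s = n * length w" "hd (s @ w) = hd w"
    by blast
  have "s @ w \<in> carrier (free_product I G)"
    using FP.nat_pow_closed[OF w(1), of "Suc n"] s(1) by simp
  then have "(s @ w) @ w \<in> carrier (free_product I G)"
    using w by (subst free_product_append) auto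
  from mult_free_product_append[OF this]
  have "w [^]\<^bsub>free_product I G\<^esub> Suc (Suc n) = (s @ w) @ w"
    using s(1) by (metis nat_pow_Suc)
  then show ?case
    using s w(2) by (intro exI[of _ "s @ w"]) (auto simp: hd_append)
qed

text \<open>These are the two ways in which a word with both outer letters in factor
  \<open>l\<close> is a conjugate, according to whether these letters cancel cyclically. The middle
  part \<open>y\<close> is general because the formulas are applied both to the word and to its
  powers.\<close>

lemma free_product_conj:
  assumes l: "l \<in> I" "a \<in> carrier (G l)" "a \<noteq> \<one>\<^bsub>G l\<^esub>"
    and y: "y \<in> carrier (free_product I G)" "y \<noteq> []" "fst (hd y) \<noteq> l" "fst (last y) \<noteq> l"
  shows "[(l, a)] \<otimes>\<^bsub>free_product I G\<^esub> y \<otimes>\<^bsub>free_product I G\<^esub> inv\<^bsub>free_product I G\<^esub> [(l, a)] =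
      (l, a) # y @ [(l, inv\<^bsub>G l\<^esub> a)]"
    and "b \<in> carrier (G l) \<Longrightarrow> b \<noteq> \<one>\<^bsub>G l\<^esub> \<Longrightarrow> b \<otimes>\<^bsub>G l\<^esub> a \<noteq> \<one>\<^bsub>G l\<^esub> \<Longrightarrow>
      [(l, a)] \<otimes>\<^bsub>free_product I G\<^esub> (y @ [(l, b \<otimes>\<^bsub>G l\<^esub> a)]) \<otimes>\<^bsub>free_product I G\<^esub>
        inv\<^bsub>free_product I G\<^esub> [(l, a)] = (l, a) # y @ [(l, b)]"
proof -
  interpret Gl: group "G l" using l(1) by (rule groups)
  let ?F = "free_product I G"
  have single: "[(l, g)] \<in> carrier ?F" if "g \<in> carrier (G l)" "g \<noteq> \<one>\<^bsub>G l\<^esub>" for g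
    using that l(1) by (simp add: free_product_Cons free_product_Nil)
  have inv: "inv\<^bsub>?F\<^esub> [(l, a)] = [(l, inv\<^bsub>G l\<^esub> a)]"
    using l single by (intro FP.inv_equality) (auto simp: mult_free_product one_free_product)
  have ay: "[(l, a)] @ y \<in> carrier ?F"
    using y single[OF l(2,3)] by (subst free_product_append) auto
  have ayg: "((l, a) # y) @ [(l, g)] \<in> carrier ?F" if "g \<in> carrier (G l)" "g \<noteq> \<one>\<^bsub>G l\<^esub>" for g
    using y single[OF that] ay by (subst free_product_append) auto
  have "[(l, a)] \<otimes>\<^bsub>?F\<^esub> y = (l, a) # y"
    using mult_free_product_append[OF ay] by simp
  moreover have "((l, a) # y) \<otimes>\<^bsub>?F\<^esub> [(l, inv\<^bsub>G l\<^esub> a)] = ((l, a) # y) @ [(l, inv\<^bsub>G l\<^esub> a)]"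
    using l by (intro mult_free_product_append ayg) auto
  ultimately show "[(l, a)] \<otimes>\<^bsub>?F\<^esub> y \<otimes>\<^bsub>?F\<^esub> inv\<^bsub>?F\<^esub> [(l, a)] = (l, a) # y @ [(l, inv\<^bsub>G l\<^esub> a)]"
    by (simp add: inv)
  assume b: "b \<in> carrier (G l)" "b \<noteq> \<one>\<^bsub>G l\<^esub>" "b \<otimes>\<^bsub>G l\<^esub> a \<noteq> \<one>\<^bsub>G l\<^esub>"
  then have ba: "b \<otimes>\<^bsub>G l\<^esub> a \<in> carrier (G l)" using l by simp
  have "[(l, a)] \<otimes>\<^bsub>?F\<^esub> (y @ [(l, b \<otimes>\<^bsub>G l\<^esub> a)]) = ((l, a) # y) @ [(l, b \<otimes>\<^bsub>G l\<^esub> a)]"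
    using mult_free_product_append[of "[(l, a)]" "y @ [(l, b \<otimes>\<^bsub>G l\<^esub> a)]" I G] ayg[OF ba b(3)] by simp
  also have "\<dots> = ((l, a) # y) \<otimes>\<^bsub>?F\<^esub> [(l, b \<otimes>\<^bsub>G l\<^esub> a)]"
    using mult_free_product_append[OF ayg[OF ba b(3)]] by simp
  also have "\<dots> \<otimes>\<^bsub>?F\<^esub> inv\<^bsub>?F\<^esub> [(l, a)] =
      ((l, a) # y) \<otimes>\<^bsub>?F\<^esub> ([(l, b \<otimes>\<^bsub>G l\<^esub> a)] \<otimes>\<^bsub>?F\<^esub> [(l, inv\<^bsub>G l\<^esub> a)])"
    unfolding inv using ay single[OF ba b(3)] single[of "inv\<^bsub>G l\<^esub> a"] l by (subst FP.m_assoc) auto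
  also have "[(l, b \<otimes>\<^bsub>G l\<^esub> a)] \<otimes>\<^bsub>?F\<^esub> [(l, inv\<^bsub>G l\<^esub> a)] = [(l, b)]"
    using l b by (simp add: mult_free_product Gl.m_assoc)
  also have "((l, a) # y) \<otimes>\<^bsub>?F\<^esub> [(l, b)] = ((l, a) # y) @ [(l, b)]"
    by (rule mult_free_product_append[OF ayg[OF b(1,2)]])
  finally show "[(l, a)] \<otimes>\<^bsub>?F\<^esub> (y @ [(l, b \<otimes>\<^bsub>G l\<^esub> a)]) \<otimes>\<^bsub>?F\<^esub> inv\<^bsub>?F\<^esub> [(l, a)] =
      (l, a) # y @ [(l, b)]"
    by simp
qed

text \<open>A nontrivial element killed by all projections is not conjugate to an element of a factor;
  conjugation makes it cyclically reduced, and then no cancellation occurs in its powers. The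
  statement about the outer letters is what the induction needs to undo a conjugation.\<close>

lemma free_product_pow_length:
  fixes n :: nat
  assumes "w \<in> carrier (free_product I G)" "w \<noteq> []"
    and "\<And>l. l \<in> I \<Longrightarrow> free_product_proj G l w = \<one>\<^bsub>G l\<^esub>"
  defines "v \<equiv> w [^]\<^bsub>free_product I G\<^esub> Suc n"
  shows "length w + n \<le> length v \<and> fst (hd v) = fst (hd w) \<and> fst (last v) = fst (last w)"
  using assms(1-3) unfolding v_def
proof (induction "length w" arbitrary: w rule: less_induct)
  case less
  let ?F = "free_product I G"
  show ?case
  proof (cases "fst (hd w) = fst (last w)")
    case False
    obtain s where s: "w [^]\<^bsub>?F\<^esub> Suc n = s @ w" "length s = n * length w" "hd (s @ w) = hd w"
      using free_product_pow_cyclically_reduced[OF less.prems(1,2) False] by blast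
    have "n \<le> n * length w" using less.prems(2) by (simp add: Suc_le_eq)
    then show ?thesis
      unfolding s(1) using s(2,3) less.prems(2) by simp
  next
    case True
    obtain l a r where w0: "w = (l, a) # r" using less.prems(2) by (cases w) auto
    then have l: "l \<in> I" "a \<in> carrier (G l)" "a \<noteq> \<one>\<^bsub>G l\<^esub>"
      using less.prems(1) by (auto simp: free_product_Cons)
    interpret Gl: group "G l" using l(1) by (rule groups)
    \<comment> \<open>A one-letter word is detected by the projection onto its own factor.\<close>
    have "r \<noteq> []"
      using less.prems(3)[OF l(1)] free_product_proj_singleton[OF l(1,2)] l(3) w0 by auto
    then obtain y b where r: "r = y @ [(l, b)]"
      using True w0 by (cases r rule: rev_cases) auto
    have w: "w = (l, a) # y @ [(l, b)]" using w0 r by simp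
    have y_ne: "y \<noteq> []"
      using less.prems(1) w by (auto simp: free_product_Cons)
    have y: "y \<in> carrier ?F" "fst (hd y) \<noteq> l" "fst (last y) \<noteq> l"
      and b: "b \<in> carrier (G l)" "b \<noteq> \<one>\<^bsub>G l\<^esub>"
      using less.prems(1) y_ne unfolding w by (auto simp: free_product_Cons free_product_append)
    have A: "[(l, a)] \<in> carrier ?F"
      using l by (simp add: free_product_Cons free_product_Nil)
    show ?thesis
    proof (cases "b \<otimes>\<^bsub>G l\<^esub> a = \<one>\<^bsub>G l\<^esub>")
      case True
      then have "b = inv\<^bsub>G l\<^esub> a"
        using Gl.inv_equality[OF True l(2) b(1)] by simp
      then have wc: "w = [(l, a)] \<otimes>\<^bsub>?F\<^esub> y \<otimes>\<^bsub>?F\<^esub> inv\<^bsub>?F\<^esub> [(l, a)]"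
        using free_product_conj(1)[OF l y(1) y_ne y(2,3)] w by simp
      \<comment> \<open>The conjugate \<open>y\<close> is again killed by all projections and is
        shorter, so the induction hypothesis applies to it.\<close>
      have "free_product_proj G m y = \<one>\<^bsub>G m\<^esub>" if m: "m \<in> I" for m
      proof -
        interpret P: group_hom ?F "G m" "free_product_proj G m"
          using free_product_proj_hom[OF m] groups[OF m] FP.group_axioms
          by (simp add: group_hom_def group_hom_axioms_def)
        have "y = inv\<^bsub>?F\<^esub> [(l, a)] \<otimes>\<^bsub>?F\<^esub> w \<otimes>\<^bsub>?F\<^esub> [(l, a)]"
          unfolding wc using A y(1) by (simp add: FP.m_assoc FP.inv_solve_left)
        then show ?thesis
          using less.prems(1,3) m A by simp
      qed
      then have IH: "length y + n \<le> length (y [^]\<^bsub>?F\<^esub> Suc n)"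
          "fst (hd (y [^]\<^bsub>?F\<^esub> Suc n)) = fst (hd y)" "fst (last (y [^]\<^bsub>?F\<^esub> Suc n)) = fst (last y)"
        using less.hyps[of y] w y(1) y_ne by auto
      have "y [^]\<^bsub>?F\<^esub> Suc n \<noteq> []"
        using IH(1) y_ne by auto
      then have "w [^]\<^bsub>?F\<^esub> Suc n = (l, a) # y [^]\<^bsub>?F\<^esub> Suc n @ [(l, inv\<^bsub>G l\<^esub> a)]"
        unfolding wc FP.conj_nat_pow[OF A y(1)]
        using free_product_conj(1)[OF l FP.nat_pow_closed[OF y(1), of "Suc n"]] IH(2,3) y
        by (simp del: nat_pow_Suc FP.nat_pow_Suc)
      then show ?thesis
        using IH(1) w by (simp del: nat_pow_Suc FP.nat_pow_Suc)
    next
      case False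
      \<comment> \<open>Conjugating moves \<open>a\<close> to the end, where it merges with
        \<open>b\<close>; the result is cyclically reduced.\<close>
      define t where "t = y @ [(l, b \<otimes>\<^bsub>G l\<^esub> a)]"
      have t: "t \<in> carrier ?F" "t \<noteq> []" "fst (hd t) \<noteq> fst (last t)"
        using y y_ne l b False by (auto simp: t_def free_product_append free_product_Cons free_product_Nil)
      have wc: "w = [(l, a)] \<otimes>\<^bsub>?F\<^esub> t \<otimes>\<^bsub>?F\<^esub> inv\<^bsub>?F\<^esub> [(l, a)]"
        using free_product_conj(2)[OF l y(1) y_ne y(2,3) b False] w by (simp add: t_def)
      obtain s where s: "t [^]\<^bsub>?F\<^esub> Suc n = s @ t" "length s = n * length t" "hd (s @ t) = hd t"
        using free_product_pow_cyclically_reduced[OF t] by blast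
      have "s @ t \<in> carrier ?F"
        using FP.nat_pow_closed[OF t(1), of "Suc n"] unfolding s(1) .
      then have "(s @ y) @ [(l, b \<otimes>\<^bsub>G l\<^esub> a)] \<in> carrier ?F" by (simp add: t_def)
      then have sy: "s @ y \<in> carrier ?F"
        by (subst (asm) free_product_append) simp
      have hd: "hd (s @ y) = hd y"
        using s(3) y_ne by (cases s) (auto simp: t_def)
      \<comment> \<open>Undoing the conjugation turns the final letter of \<open>s @ t\<close> back
        into \<open>b\<close> and puts \<open>a\<close> in front.\<close>
      have "w [^]\<^bsub>?F\<^esub> Suc n = (l, a) # (s @ y) @ [(l, b)]"
        unfolding wc FP.conj_nat_pow[OF A t(1)] s(1)
        using free_product_conj(2)[OF l sy _ _ _ b False] hd y y_ne by (simp add: t_def)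
      moreover have "n \<le> length s"
        using s(2) t(2) by (simp add: Suc_le_eq)
      ultimately show ?thesis
        using w by (simp del: nat_pow_Suc FP.nat_pow_Suc)
    qed
  qed
qed

text \<open>The map \<open>\<pi>\<close> collects the projections and lands in the direct sum, as
  only the factors occurring in a word contribute. Its kernel consists of the words killed by every
  projection, where word length has the growth required by
  \<open>kills_generator_length\<close>.\<close>

lemma kills_generator_free_product:
  assumes kills: "\<And>l. l \<in> I \<Longrightarrow> kills_generator (G l)"
  shows "kills_generator (free_product I G)"
proof -
  let ?F = "free_product I G" and ?S = "sum_group I G"
  define \<pi> where "\<pi> w = (\<lambda>l\<in>I. free_product_proj G l w)" for w
  have trivial: "free_product_proj G l w = \<one>\<^bsub>G l\<^esub>" if "l \<in> I" "l \<notin> fst ` set w" for l w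
  proof -
    interpret group "G l" using that(1) by (rule groups)
    show ?thesis
      using that(2) by (induction w) (auto simp: free_product_proj_def free_product_lift_def)
  qed
  have "\<pi> \<in> hom ?F ?S"
  proof (rule homI)
    fix w assume w: "w \<in> carrier ?F"
    have "{l \<in> I. \<pi> w l \<noteq> \<one>\<^bsub>G l\<^esub>} \<subseteq> fst ` set w"
      using trivial by (auto simp: \<pi>_def)
    then have "finite {l \<in> I. \<pi> w l \<noteq> \<one>\<^bsub>G l\<^esub>}"
      by (rule finite_subset) simp
    then show "\<pi> w \<in> carrier ?S"
      using hom_in_carrier[OF free_product_proj_hom w] groups
      by (simp add: carrier_sum_group) (simp add: \<pi>_def)
  next
    fix v w assume "v \<in> carrier ?F" "w \<in> carrier ?F"
    then show "\<pi> (v \<otimes>\<^bsub>?F\<^esub> w) = \<pi> v \<otimes>\<^bsub>?S\<^esub> \<pi> w"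
      using hom_mult[OF free_product_proj_hom] by (auto simp: \<pi>_def)
  qed
  then interpret \<pi>: group_hom ?F ?S \<pi>
    by (simp add: group_hom_def group_hom_axioms_def FP.group_axioms groups)
  let ?K = "?F\<lparr>carrier := kernel ?F ?S \<pi>\<rparr>"
  have pow: "x [^]\<^bsub>?K\<^esub> k = x [^]\<^bsub>?F\<^esub> k" for x and k :: nat
    by (rule FP.nat_pow_consistent[symmetric])
  have "kills_generator ?K"
  proof (rule kills_generator_length[of _ length])
    show "group ?K"
      by (rule FP.subgroup_imp_group[OF \<pi>.subgroup_kernel])
    fix x n assume x: "x \<in> carrier ?K" "x \<noteq> \<one>\<^bsub>?K\<^esub>"
    have "free_product_proj G l x = \<one>\<^bsub>G l\<^esub>" if "l \<in> I" for l
      using x(1) that by (auto simp: kernel_def \<pi>_def dest!: fun_cong[of _ _ l])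
    then show "length x + n \<le> length (x [^]\<^bsub>?K\<^esub> Suc n)"
      unfolding pow using free_product_pow_length[of x n] x by (simp add: kernel_def one_free_product)
  qed (simp_all add: one_free_product length_mult_free_product)
  then show ?thesis
    using kills_generator_extension[OF \<pi>.homh kills_generator_sum_group[OF groups kills]] by blast
qed

end

section \<open>From \<open>kills_generator\<close> back to inverse limit slender groups\<close>

theorem theorem1:
  assumes "infinite (UNIV :: 'h set)"
  shows
    "(\<forall>G :: 'g monoid. group G \<longrightarrow>
        (inverse_limit_slender TYPE('h) G \<longleftrightarrow>
          (\<forall>\<phi>\<in>hom F_hat G. factors_through_projection F_seq F_bond G \<phi>))) \<and>
     (\<forall>(G :: 'g monoid) A. inverse_limit_slender TYPE('h) G \<longrightarrow> subgroup A G \<longrightarrow>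
        inverse_limit_slender TYPE('h) (G\<lparr>carrier := A\<rparr>)) \<and>
     (\<forall>(G :: 'g monoid) A. A \<lhd> G \<longrightarrow>
        inverse_limit_slender TYPE('h) (G\<lparr>carrier := A\<rparr>) \<longrightarrow>
        inverse_limit_slender TYPE('h) (G Mod A) \<longrightarrow>
        inverse_limit_slender TYPE('h) G) \<and>
     (\<forall>(\<Lambda> :: 'l set) (G :: 'l \<Rightarrow> 'g monoid).
        (\<forall>l\<in>\<Lambda>. inverse_limit_slender TYPE('h) (G l)) \<longrightarrow>
        inverse_limit_slender TYPE('h) (sum_group \<Lambda> G) \<and>
        inverse_limit_slender TYPE('h) (free_product \<Lambda> G))"
proof (intro conjI allI impI)
  note slender_iff = slender_iff_kills_generator[OF assms]
  fix G :: "'g monoid" and A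
  {
    assume "group G"
    then show "inverse_limit_slender TYPE('h) G \<longleftrightarrow>
        (\<forall>\<phi>\<in>hom F_hat G. factors_through_projection F_seq F_bond G \<phi>)"
      by (simp add: slender_iff kills_generator_iff_factors)
  next
    assume "inverse_limit_slender TYPE('h) G" "subgroup A G"
    then show "inverse_limit_slender TYPE('h) (G\<lparr>carrier := A\<rparr>)"
      by (simp add: slender_iff group.subgroup_imp_group kills_generator_subgroup)
  next
    assume A: "A \<lhd> G" and slender: "inverse_limit_slender TYPE('h) (G\<lparr>carrier := A\<rparr>)"
      "inverse_limit_slender TYPE('h) (G Mod A)"
    interpret normal A G by fact
    \<comment> \<open>The extension lemma speaks of the kernel of a homomorphism; here it is applied
      to the quotient map.\<close>
    have "kernel G (G Mod A) (\<lambda>x. A #>\<^bsub>G\<^esub> x) = A"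
      using coset_join1[OF _ _ subgroup_axioms] coset_join2[OF _ subgroup_axioms] subset
      by (auto simp: kernel_def)
    then show "inverse_limit_slender TYPE('h) G"
      using slender kills_generator_extension[OF r_coset_hom_Mod] by (simp add: slender_iff group_axioms)
  }
next
  fix \<Lambda> :: "'l set" and G :: "'l \<Rightarrow> 'g monoid"
  assume "\<forall>l\<in>\<Lambda>. inverse_limit_slender TYPE('h) (G l)"
  then have G: "group (G l)" "kills_generator (G l)" if "l \<in> \<Lambda>" for l
    using that by (simp_all add: slender_iff_kills_generator[OF assms])
  show "inverse_limit_slender TYPE('h) (sum_group \<Lambda> G)"
    using G kills_generator_sum_group[of \<Lambda> G] by (simp add: slender_iff_kills_generator[OF assms])
  show "inverse_limit_slender TYPE('h) (free_product \<Lambda> G)"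
    using G kills_generator_free_product[of \<Lambda> G] group_free_product[of \<Lambda> G]
    by (simp add: slender_iff_kills_generator[OF assms])
qed

end
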